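(* Let $\Omega$ be a bounded Lipschitz domain, let $\Sigma_h\subset\mathbf{H}(\mathrm{div};\Omega)$ and $U_h\subset H^1_0(\Omega)$ be finite dimensional (conforming finite element) subspaces with chosen bases, and let $\mathsf{A}$, $\mathsf{B}$, $\mathsf{C}$ be the matrices associated, respectively, with the bilinear forms $(\boldsymbol{\sigma},\boldsymbol{\tau})+(\mathrm{div}\,\boldsymbol{\sigma},\mathrm{div}\,\boldsymbol{\tau})$ on $\Sigma_h\times\Sigma_h$, $-(\boldsymbol{\sigma},\nabla v)$ on $\Sigma_h\times U_h$, and $(\nabla u,\nabla v)$ on $U_h\times U_h$. Then the generalized eigenvalue problem $$\begin{pmatrix}\mathsf{A}&\mathsf{B}^\top\\ \mathsf{B}&\mathsf{C}\end{pmatrix}\begin{pmatrix}\mathsf{x}\\ \mathsf{y}\end{pmatrix}=\lambda_h\begin{pmatrix}0&-\mathsf{B}^\top\\ 0&0\end{pmatrix}\begin{pmatrix}\mathsf{x}\\ \mathsf{y}\end{pmatrix}$$ has three families of eigenvalues: (1) $\lambda_h=\infty$ with multiplicity equal to $\dim\Sigma_h$; (2) $\lambda_h=\infty$ with multiplicity equal to $\dim\ker(\mathsf{B}^\top)$; (3) a number of positive eigenvalues $\lambda_h$ (counted with their multiplicities) equal to $\mathrm{rank}(\mathsf{B}^\top)$.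
   Context: $(\cdot,\cdot)$ is the $L^2(\Omega)$ (or $L^2(\Omega)^d$) inner product; $\mathbf{H}(\mathrm{div};\Omega)=\{\boldsymbol{\tau}\in L^2(\Omega)^d:\mathrm{div}\,\boldsymbol{\tau}\in L^2(\Omega)\}$. The matrix $\mathsf{B}$ has $\dim U_h$ rows (test functions $v\in U_h$) and $\dim\Sigma_h$ columns; $\mathsf{B}^\top$ acts on coefficient vectors $\mathsf{y}$ of elements of $U_h$. Convention for a generalized eigenvalue problem $\mathcal{A}z=\lambda\mathcal{B}z$ with $\mathcal{A}$ invertible and $\mathcal{B}$ singular: $\lambda=\infty$ is an eigenvalue with eigenspace $\ker\mathcal{B}$; equivalently one considers $\mathcal{B}z=\mu\mathcal{A}z$, where $\mu=0$ corresponds to $\lambda=\infty$ and $\mu\ne0$ to $\lambda=1/\mu$. The total multiplicity is $\dim\Sigma_h+\dim U_h$, and families (1) and (2) together make up the eigenvalue $\infty$. *)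

theory Defs
  imports
    "HOL-Analysis.Analysis"
    "Jordan_Normal_Form.Matrix_Kernel"
    "Jordan_Normal_Form.DL_Rank"
begin

text \<open>
  The space \<open>\<real>\<^sup>d\<close> is a Euclidean type \<open>'a\<close> with \<open>d = DIM('a)\<close>. An element of
  \<open>L\<^sup>2(\<Omega>)\<close> is represented by any of its representatives, a function on all of \<open>'a\<close> whose
  values outside \<open>\<Omega>\<close> are irrelevant; linear independence, spanning and dimension are
  accordingly taken modulo equality almost everywhere in \<open>\<Omega>\<close>.
\<close>

section \<open>Lipschitz domains\<close>

text \<open>
  Near every boundary point, \<open>\<Omega>\<close> is the epigraph, in some direction \<open>e\<close>, of a Lipschitz
  function on the hyperplane orthogonal to \<open>e\<close>.
\<close>

definition lipschitz_boundary :: "'a::euclidean_space set \<Rightarrow> bool" where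
  "lipschitz_boundary \<Omega> \<longleftrightarrow>
     (\<forall>p \<in> frontier \<Omega>. \<exists>r e L \<gamma>. 0 < r \<and> norm e = 1 \<and> L-lipschitz_on {y. inner y e = 0} \<gamma> \<and>
        \<Omega> \<inter> ball p r = {x \<in> ball p r. \<gamma> (x - inner x e *\<^sub>R e) < inner x e})"

definition lipschitz_domain :: "'a::euclidean_space set \<Rightarrow> bool" where
  "lipschitz_domain \<Omega> \<longleftrightarrow> open \<Omega> \<and> connected \<Omega> \<and> \<Omega> \<noteq> {} \<and> lipschitz_boundary \<Omega>"


section \<open>Square integrable functions\<close>

definition L2 :: "'a::euclidean_space set \<Rightarrow> ('a \<Rightarrow> 'b::euclidean_space) set" where
  "L2 \<Omega> = {f \<in> borel_measurable (lebesgue_on \<Omega>). integrable (lebesgue_on \<Omega>) (\<lambda>x. (norm (f x))\<^sup>2)}"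

definition l2_inner ::
  "'a::euclidean_space set \<Rightarrow> ('a \<Rightarrow> 'b::euclidean_space) \<Rightarrow> ('a \<Rightarrow> 'b) \<Rightarrow> real" where
  "l2_inner \<Omega> f g = integral\<^sup>L (lebesgue_on \<Omega>) (\<lambda>x. inner (f x) (g x))"

definition l2_norm :: "'a::euclidean_space set \<Rightarrow> ('a \<Rightarrow> 'b::euclidean_space) \<Rightarrow> real" where
  "l2_norm \<Omega> f = sqrt (l2_inner \<Omega> f f)"


section \<open>Test functions\<close>

primrec iterated_deriv :: "'a::euclidean_space list \<Rightarrow> ('a \<Rightarrow> real) \<Rightarrow> 'a \<Rightarrow> real" where
  "iterated_deriv [] \<phi> = \<phi>"
| "iterated_deriv (v # vs) \<phi> = (\<lambda>x. frechet_derivative (iterated_deriv vs \<phi>) (at x) v)"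

definition smooth :: "('a::euclidean_space \<Rightarrow> real) \<Rightarrow> bool" where
  "smooth \<phi> \<longleftrightarrow> (\<forall>vs x. iterated_deriv vs \<phi> differentiable (at x))"

definition test_functions :: "'a::euclidean_space set \<Rightarrow> ('a \<Rightarrow> real) set" where
  "test_functions \<Omega> =
     {\<phi>. smooth \<phi> \<and> compact (closure {x. \<phi> x \<noteq> 0}) \<and> closure {x. \<phi> x \<noteq> 0} \<subseteq> \<Omega>}"

definition grad :: "('a::euclidean_space \<Rightarrow> real) \<Rightarrow> 'a \<Rightarrow> 'a" where
  "grad \<phi> x = (\<Sum>b\<in>Basis. frechet_derivative \<phi> (at x) b *\<^sub>R b)"


section \<open>Weak derivatives and Sobolev spaces\<close>

definition is_weak_div :: "'a::euclidean_space set \<Rightarrow> ('a \<Rightarrow> 'a) \<Rightarrow> ('a \<Rightarrow> real) \<Rightarrow> bool" where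
  "is_weak_div \<Omega> \<tau> g \<longleftrightarrow>
     g \<in> L2 \<Omega> \<and> (\<forall>\<phi>\<in>test_functions \<Omega>. l2_inner \<Omega> \<tau> (grad \<phi>) = - l2_inner \<Omega> g \<phi>)"

definition is_weak_grad :: "'a::euclidean_space set \<Rightarrow> ('a \<Rightarrow> real) \<Rightarrow> ('a \<Rightarrow> 'a) \<Rightarrow> bool" where
  "is_weak_grad \<Omega> u G \<longleftrightarrow>
     G \<in> L2 \<Omega> \<and>
     (\<forall>\<phi>\<in>test_functions \<Omega>. \<forall>b\<in>Basis.
        l2_inner \<Omega> u (\<lambda>x. inner (grad \<phi> x) b) = - l2_inner \<Omega> (\<lambda>x. inner (G x) b) \<phi>)"

text \<open>
  Weak derivatives are unique up to null sets, so the choice of a representative does not affect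
  any of the integrals below.
\<close>

definition weak_div :: "'a::euclidean_space set \<Rightarrow> ('a \<Rightarrow> 'a) \<Rightarrow> 'a \<Rightarrow> real" where
  "weak_div \<Omega> \<tau> = (SOME g. is_weak_div \<Omega> \<tau> g)"

definition weak_grad :: "'a::euclidean_space set \<Rightarrow> ('a \<Rightarrow> real) \<Rightarrow> 'a \<Rightarrow> 'a" where
  "weak_grad \<Omega> u = (SOME G. is_weak_grad \<Omega> u G)"

definition Hdiv :: "'a::euclidean_space set \<Rightarrow> ('a \<Rightarrow> 'a) set" where
  "Hdiv \<Omega> = {\<tau> \<in> L2 \<Omega>. \<exists>g. is_weak_div \<Omega> \<tau> g}"

definition H1 :: "'a::euclidean_space set \<Rightarrow> ('a \<Rightarrow> real) set" where
  "H1 \<Omega> = {u \<in> L2 \<Omega>. \<exists>G. is_weak_grad \<Omega> u G}"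

text \<open>\<open>H\<^sup>1\<^sub>0(\<Omega>)\<close> is the closure of the test functions in the norm of \<open>H\<^sup>1(\<Omega>)\<close>.\<close>

definition H10 :: "'a::euclidean_space set \<Rightarrow> ('a \<Rightarrow> real) set" where
  "H10 \<Omega> = {u \<in> H1 \<Omega>. \<forall>\<epsilon>>0. \<exists>\<phi>\<in>test_functions \<Omega>.
      l2_norm \<Omega> (\<lambda>x. u x - \<phi> x) < \<epsilon> \<and> l2_norm \<Omega> (\<lambda>x. weak_grad \<Omega> u x - grad \<phi> x) < \<epsilon>}"


section \<open>Finite dimensional function spaces modulo null sets\<close>

definition fun_subspace :: "('a \<Rightarrow> 'b::real_vector) set \<Rightarrow> bool" where
  "fun_subspace V \<longleftrightarrow> (\<lambda>_. 0) \<in> V \<and> (\<forall>f\<in>V. \<forall>g\<in>V. (\<lambda>x. f x + g x) \<in> V) \<and>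
     (\<forall>c. \<forall>f\<in>V. (\<lambda>x. c *\<^sub>R f x) \<in> V)"

definition ae_spans ::
  "'a::euclidean_space set \<Rightarrow> ('a \<Rightarrow> 'b::euclidean_space) list \<Rightarrow> ('a \<Rightarrow> 'b) set \<Rightarrow> bool" where
  "ae_spans \<Omega> bs V \<longleftrightarrow>
     (\<forall>f\<in>V. \<exists>c. AE x in lebesgue_on \<Omega>. f x = (\<Sum>i<length bs. c i *\<^sub>R (bs ! i) x))"

definition ae_independent ::
  "'a::euclidean_space set \<Rightarrow> ('a \<Rightarrow> 'b::euclidean_space) list \<Rightarrow> bool" where
  "ae_independent \<Omega> bs \<longleftrightarrow>
     (\<forall>c. (AE x in lebesgue_on \<Omega>. (\<Sum>i<length bs. c i *\<^sub>R (bs ! i) x) = 0) \<longrightarrow>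
        (\<forall>i<length bs. c i = 0))"

definition ae_basis ::
  "'a::euclidean_space set \<Rightarrow> ('a \<Rightarrow> 'b::euclidean_space) list \<Rightarrow> ('a \<Rightarrow> 'b) set \<Rightarrow> bool" where
  "ae_basis \<Omega> bs V \<longleftrightarrow> set bs \<subseteq> V \<and> ae_spans \<Omega> bs V \<and> ae_independent \<Omega> bs"

definition ae_dim :: "'a::euclidean_space set \<Rightarrow> ('a \<Rightarrow> 'b::euclidean_space) set \<Rightarrow> nat" where
  "ae_dim \<Omega> V = (THE n. \<exists>bs. ae_basis \<Omega> bs V \<and> length bs = n)"

lemma wide_matrix_kernel:
  fixes C :: "nat \<Rightarrow> nat \<Rightarrow> real"
  assumes "q < p"
  shows "\<exists>c. (\<exists>i<p. c i \<noteq> 0) \<and> (\<forall>j<q. (\<Sum>i<p. c i * C i j) = 0)"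
proof -
  let ?M = "Matrix.mat p p (\<lambda>(j, i). if j < q then C i j else 0)"
  have "Determinant.det ?M = 0"
    using assms by (subst det_def'[of _ p])
      (auto intro!: sum.neutral prod_zero bexI[of _ q] simp: permutes_in_image)
  then obtain v where v: "v \<in> carrier_vec p" "v \<noteq> 0\<^sub>v p" "?M *\<^sub>v v = 0\<^sub>v p"
    using det_0_iff_vec_prod_zero_field[of ?M p] by auto
  have "\<exists>i<p. vec_index v i \<noteq> 0"
  proof (rule ccontr)
    assume "\<not> (\<exists>i<p. vec_index v i \<noteq> 0)"
    then have "v = 0\<^sub>v p" using v(1) by (intro eq_vecI) auto
    then show False using v(2) by simp
  qed
  moreover have "(\<Sum>i<p. vec_index v i * C i j) = 0" if "j < q" for j
  proof -
    have "vec_index (?M *\<^sub>v v) j = 0" using v(3) that assms by simp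
    then show ?thesis
      using that assms v(1) by (simp add: scalar_prod_def lessThan_atLeast0 mult.commute)
  qed
  ultimately show ?thesis by blast
qed

lemma ae_independent_length_le:
  assumes bs: "ae_independent \<Omega> bs" "set bs \<subseteq> V" and cs: "ae_spans \<Omega> cs V"
  shows "length bs \<le> length cs"
proof (rule ccontr)
  assume "\<not> length bs \<le> length cs"
  then have lt: "length cs < length bs" by simp
  have "\<exists>c. AE x in lebesgue_on \<Omega>. (bs ! i) x = (\<Sum>j<length cs. c j *\<^sub>R (cs ! j) x)"
    if "i < length bs" for i
    using cs bs(2) that nth_mem unfolding ae_spans_def by blast
  then obtain C where C: "\<And>i. i < length bs \<Longrightarrow>
      AE x in lebesgue_on \<Omega>. (bs ! i) x = (\<Sum>j<length cs. C i j *\<^sub>R (cs ! j) x)"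
    by metis
  obtain c where c: "\<exists>i<length bs. c i \<noteq> 0"
    "\<And>j. j < length cs \<Longrightarrow> (\<Sum>i<length bs. c i * C i j) = 0"
    using wide_matrix_kernel[OF lt, of C] by auto
  have "AE x in lebesgue_on \<Omega>. \<forall>i\<in>{..<length bs}.
      (bs ! i) x = (\<Sum>j<length cs. C i j *\<^sub>R (cs ! j) x)"
    using C by (intro AE_finite_allI) auto
  then have "AE x in lebesgue_on \<Omega>. (\<Sum>i<length bs. c i *\<^sub>R (bs ! i) x) = 0"
  proof eventually_elim
    case (elim x)
    have "(\<Sum>i<length bs. c i *\<^sub>R (bs ! i) x)
        = (\<Sum>i<length bs. \<Sum>j<length cs. (c i * C i j) *\<^sub>R (cs ! j) x)"
      using elim by (simp add: scaleR_sum_right)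
    also have "\<dots> = (\<Sum>j<length cs. \<Sum>i<length bs. (c i * C i j) *\<^sub>R (cs ! j) x)"
      by (rule sum.swap)
    also have "\<dots> = (\<Sum>j<length cs. (\<Sum>i<length bs. c i * C i j) *\<^sub>R (cs ! j) x)"
      by (simp add: scaleR_sum_left)
    also have "\<dots> = 0" using c(2) by simp
    finally show ?case .
  qed
  then show False using bs(1) c(1) unfolding ae_independent_def by blast
qed

lemma ae_dim_eq_length:
  assumes "ae_basis \<Omega> bs V"
  shows "ae_dim \<Omega> V = length bs"
  unfolding ae_dim_def using assms ae_independent_length_le
  by (intro the_equality) (auto simp: ae_basis_def intro!: le_antisym)


section \<open>Galerkin matrices\<close>

text \<open>In every entry, the row index belongs to the test function.\<close>

definition mat_A :: "'a::euclidean_space set \<Rightarrow> ('a \<Rightarrow> 'a) list \<Rightarrow> real mat" where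
  "mat_A \<Omega> \<sigma>s = Matrix.mat (length \<sigma>s) (length \<sigma>s) (\<lambda>(i, j).
     l2_inner \<Omega> (\<sigma>s ! j) (\<sigma>s ! i) + l2_inner \<Omega> (weak_div \<Omega> (\<sigma>s ! j)) (weak_div \<Omega> (\<sigma>s ! i)))"

definition mat_B ::
  "'a::euclidean_space set \<Rightarrow> ('a \<Rightarrow> 'a) list \<Rightarrow> ('a \<Rightarrow> real) list \<Rightarrow> real mat" where
  "mat_B \<Omega> \<sigma>s us = Matrix.mat (length us) (length \<sigma>s) (\<lambda>(i, j).
     - l2_inner \<Omega> (\<sigma>s ! j) (weak_grad \<Omega> (us ! i)))"

definition mat_C :: "'a::euclidean_space set \<Rightarrow> ('a \<Rightarrow> real) list \<Rightarrow> real mat" where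
  "mat_C \<Omega> us = Matrix.mat (length us) (length us) (\<lambda>(i, j).
     l2_inner \<Omega> (weak_grad \<Omega> (us ! j)) (weak_grad \<Omega> (us ! i)))"


section \<open>Generalized eigenvalue problems\<close>

text \<open>
  The problem \<open>P z = \<lambda> Q z\<close> with \<open>P\<close> invertible, over the complex numbers. The eigenvalue
  \<open>\<lambda> = \<infinity>\<close> stands for \<open>\<mu> = 0\<close> in the reciprocal problem \<open>Q z = \<mu> P z\<close>.
\<close>

datatype gen_eigval = Fin complex | Infty

fun gen_eigenspace :: "complex mat \<Rightarrow> complex mat \<Rightarrow> gen_eigval \<Rightarrow> complex vec set" where
  "gen_eigenspace P Q (Fin l) = mat_kernel (P - l \<cdot>\<^sub>m Q)"
| "gen_eigenspace P Q Infty = mat_kernel Q"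

definition gen_eigenvalue :: "complex mat \<Rightarrow> complex mat \<Rightarrow> gen_eigval \<Rightarrow> bool" where
  "gen_eigenvalue P Q e \<longleftrightarrow> (\<exists>z\<in>gen_eigenspace P Q e. z \<noteq> 0\<^sub>v (dim_col P))"

fun geom_mult :: "complex mat \<Rightarrow> complex mat \<Rightarrow> gen_eigval \<Rightarrow> nat" where
  "geom_mult P Q (Fin l) = kernel_dim (P - l \<cdot>\<^sub>m Q)"
| "geom_mult P Q Infty = kernel_dim Q"

definition pencil_poly :: "complex mat \<Rightarrow> complex mat \<Rightarrow> complex poly" where
  "pencil_poly P Q =
     Determinant.det (map_mat (\<lambda>a. [:a:]) P - [:0, 1:] \<cdot>\<^sub>m map_mat (\<lambda>a. [:a:]) Q)"

fun alg_mult :: "complex mat \<Rightarrow> complex mat \<Rightarrow> gen_eigval \<Rightarrow> nat" where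
  "alg_mult P Q (Fin l) = Polynomial.order l (pencil_poly P Q)"
| "alg_mult P Q Infty = Polynomial.order 0 (pencil_poly Q P)"

end

theory Submission
  imports Defs
    "Jordan_Normal_Form.Jordan_Normal_Form_Existence"
    "Jordan_Normal_Form.Jordan_Normal_Form_Uniqueness"
begin

text \<open>
  Completing the square, the quadratic form of \<open>P\<close> at \<open>(x, y)\<close> is
  \<open>\<parallel>\<sigma> - \<nabla>u\<parallel>\<^sup>2 + \<parallel>div \<sigma>\<parallel>\<^sup>2\<close>. If it vanishes, then \<open>\<sigma> = \<nabla>u\<close> and
  \<open>(\<sigma>, \<nabla>u) = -(div \<sigma>, u) = 0\<close>, so \<open>\<sigma> = \<nabla>u = 0\<close>, and \<open>u = 0\<close> since \<open>u\<close> lies in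
  \<open>H\<^sup>1\<^sub>0(\<Omega>)\<close>; hence \<open>P\<close> is positive definite.

  With \<open>G = B A\<^sup>-\<^sup>1 B\<^sup>T\<close> this makes \<open>A\<close>, \<open>C\<close> and \<open>C - G\<close> positive definite.
  Diagonalizing \<open>G\<close> with respect to \<open>C\<close> gives numbers \<open>0 \<le> d\<^sub>i < 1\<close>, and eliminating \<open>x\<close>
  shows that \<open>P - l Q\<close> is equivalent to the diagonal matrix with entries \<open>1\<close> (\<open>n\<close> times) and
  \<open>1 - (1 + l) d\<^sub>i\<close>. So the finite eigenvalues are \<open>1 / d\<^sub>i - 1 > 0\<close> for \<open>d\<^sub>i \<noteq> 0\<close>, while the
  indices with \<open>d\<^sub>i = 0\<close> count the dimension of the kernel of \<open>G\<close>, which is that of \<open>B\<^sup>T\<close>.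
\<close>

section \<open>Kernels, rank and diagonalization\<close>

lemma jordan_matrix_blocks_1:
  "jordan_matrix (map (Pair 1) as) = mat_diag (length as) (\<lambda>i. as ! i)"
proof (induction as)
  case Nil
  show ?case by (rule eq_matI) (auto simp: mat_diag_def)
next
  case (Cons a as)
  have *: "sum_list (map fst (map (Pair (1::nat)) as)) = length as"
    by (induction as) auto
  show ?case
    unfolding list.map jordan_matrix_Cons Cons *
    by (rule eq_matI) (auto simp: mat_diag_def four_block_mat_def jordan_block_def Let_def nth_Cons')
qed

text \<open>The kernel is the generalized eigenspace of order 1 for the eigenvalue 0, and a diagonal
  matrix is a Jordan matrix with blocks of size 1. The known dimension formula for Jordan matrices
  then counts the zero entries.\<close>

lemma kernel_dim_mat_diag:
  fixes f :: "nat \<Rightarrow> 'a::field"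
  shows "kernel_dim (mat_diag n f) = card {i. i < n \<and> f i = 0}"
proof -
  let ?as = "map f [0..<n]"
  have "mat_diag n f = mat_diag (length ?as) (\<lambda>i. ?as ! i)"
    by (rule eq_matI) (auto simp: mat_diag_def)
  also have "\<dots> = char_matrix (jordan_matrix (map (Pair 1) ?as)) 0 ^\<^sub>m 1"
    unfolding jordan_matrix_blocks_1 by (simp add: char_matrix_def mat_diag_def)
       (rule eq_matI; simp)
  finally have "kernel_dim (mat_diag n f) = dim_gen_eigenspace (jordan_matrix (map (Pair 1) ?as)) 0 1"
    unfolding dim_gen_eigenspace_def by simp
  also have "\<dots> = length (filter (\<lambda>a. a = 0) ?as)"
    unfolding dim_gen_eigenspace_jordan_matrix
    by (induction n) (auto simp: filter_map o_def)
  also have "\<dots> = card {i. i < n \<and> f i = 0}"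
    by (simp add: length_filter_conv_card cong: conj_cong)
  finally show ?thesis .
qed

lemma det_nonzero_inverse:
  fixes M :: "'a::field mat"
  assumes "M \<in> carrier_mat n n" "Determinant.det M \<noteq> 0"
  obtains Mi where "Mi \<in> carrier_mat n n" "Mi * M = 1\<^sub>m n" "M * Mi = 1\<^sub>m n"
  using det_non_zero_imp_unit[OF assms, of "()"] by (auto simp: Units_def ring_mat_def)

text \<open>The left factor leaves the kernel itself unchanged; the right factor moves it by an
  isomorphism.\<close>

lemma kernel_dim_mult_invertible:
  fixes E :: "'a::field mat"
  assumes "L \<in> carrier_mat n n" "E \<in> carrier_mat n n" "R \<in> carrier_mat n n"
    and L: "Determinant.det L \<noteq> 0" and R: "Determinant.det R \<noteq> 0"
  shows "kernel_dim (L * E * R) = kernel_dim E"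
proof -
  obtain Li where Li: "Li \<in> carrier_mat n n" "Li * L = 1\<^sub>m n"
    using det_nonzero_inverse[OF assms(1) L] by metis
  obtain Ri where Ri: "Ri \<in> carrier_mat n n" "R * Ri = 1\<^sub>m n"
    using det_nonzero_inverse[OF assms(3) R] by metis
  have LE: "L * E \<in> carrier_mat n n" using assms by simp
  have "kernel.dim n (L * E * R) = kernel.dim n (L * E)"
    by (rule mat_kernel_dim_mult_eq_right[OF LE assms(3) Ri])
  moreover have "mat_kernel (L * E) = mat_kernel E"
    by (rule mat_kernel_mult_eq[OF assms(2,1) Li])
  ultimately show ?thesis using assms by (simp add: kernel_dim_def)
qed

text \<open>Serves the comparison of the block sizes of a Jordan form capped at 1 with those capped
  at 2.\<close>

lemma sum_list_map_less:
  fixes f g :: "'b \<Rightarrow> nat"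
  assumes "\<And>x. x \<in> set xs \<Longrightarrow> f x \<le> g x" "y \<in> set xs" "f y < g y"
  shows "(\<Sum>x\<leftarrow>xs. f x) < (\<Sum>x\<leftarrow>xs. g x)"
  using assms
proof (induction xs)
  case (Cons a xs)
  have "(\<Sum>x\<leftarrow>xs. f x) \<le> (\<Sum>x\<leftarrow>xs. g x)" using Cons.prems by (intro sum_list_mono) auto
  then show ?case using Cons by (cases "a = y") (fastforce intro: add_le_less_mono add_less_le_mono)+
qed simp

text \<open>A Jordan block of size at least 2 would make the kernel of the square strictly larger.\<close>

lemma jordan_nf_blocks_1:
  assumes A: "A \<in> carrier_mat n n" and jnf: "jordan_nf A n_as"
    and semisimple: "\<And>e v. v \<in> carrier_vec n \<Longrightarrow>
      char_matrix A e *\<^sub>v (char_matrix A e *\<^sub>v v) = 0\<^sub>v n \<Longrightarrow> char_matrix A e *\<^sub>v v = 0\<^sub>v n"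
  shows "n_as = map (Pair 1) (map snd n_as)"
proof -
  have "k = 1" if "(k, e) \<in> set n_as" for k e
  proof (rule ccontr)
    assume "k \<noteq> 1"
    moreover have "k \<noteq> 0" using that jnf by (force simp: jordan_nf_def)
    ultimately have k: "k \<ge> 2" by simp
    let ?C = "char_matrix A e"
    have C: "?C \<in> carrier_mat n n" using A by simp
    have "mat_kernel (?C * ?C) = mat_kernel ?C"
    proof
      show "mat_kernel ?C \<subseteq> mat_kernel (?C * ?C)"
        using C by (rule mat_kernel_mult_subset) (rule C)
      show "mat_kernel (?C * ?C) \<subseteq> mat_kernel ?C"
        using C semisimple[of _ e] by (auto simp: mat_kernel_def assoc_mult_mat_vec[OF C C])
    qed
    then have "dim_gen_eigenspace A e 2 = dim_gen_eigenspace A e 1"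
      unfolding dim_gen_eigenspace_def kernel_dim_def using C by (simp add: numeral_2_eq_2)
    moreover have "(\<Sum>n\<leftarrow>map fst [(n, a)\<leftarrow>n_as. a = e]. min 1 n)
        < (\<Sum>n\<leftarrow>map fst [(n, a)\<leftarrow>n_as. a = e]. min 2 n)"
      using that k by (intro sum_list_map_less[of _ _ _ k]) force+
    ultimately show False unfolding dim_gen_eigenspace[OF jnf] by simp
  qed
  then have "map (Pair 1 \<circ> snd) n_as = map id n_as" by (intro map_cong) auto
  then show ?thesis by simp
qed

section \<open>Complexification of real matrices\<close>

lemma map_vec_Re_mult:
  assumes "M \<in> carrier_mat n m" "v \<in> carrier_vec m"
  shows "map_vec Re (map_mat complex_of_real M *\<^sub>v v) = M *\<^sub>v map_vec Re v"
  using assms by (intro eq_vecI) (auto simp: scalar_prod_def Re_sum)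

lemma map_vec_Im_mult:
  assumes "M \<in> carrier_mat n m" "v \<in> carrier_vec m"
  shows "map_vec Im (map_mat complex_of_real M *\<^sub>v v) = M *\<^sub>v map_vec Im v"
  using assms by (intro eq_vecI) (auto simp: scalar_prod_def Im_sum)

text \<open>A real matrix acts separately on real and imaginary parts. This carries an equality of
  kernels of real matrices over to the complex numbers.\<close>

lemma mat_kernel_of_real_iff:
  assumes "M \<in> carrier_mat n m" "v \<in> carrier_vec m"
  shows "v \<in> mat_kernel (map_mat complex_of_real M)
    \<longleftrightarrow> map_vec Re v \<in> mat_kernel M \<and> map_vec Im v \<in> mat_kernel M"
proof -
  have *: "w = 0\<^sub>v n \<longleftrightarrow> map_vec Re w = 0\<^sub>v n \<and> map_vec Im w = 0\<^sub>v n" if "w \<in> carrier_vec n" for w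
    using that by (auto simp: vec_eq_iff complex_eq_iff)
  show ?thesis
    using assms *[of "map_mat complex_of_real M *\<^sub>v v"]
    by (auto simp: mat_kernel_def map_vec_Re_mult[symmetric] map_vec_Im_mult[symmetric])
qed

section \<open>Symmetric positive definite matrices\<close>

definition pos_def_mat :: "nat \<Rightarrow> real mat \<Rightarrow> bool" where
  "pos_def_mat n M \<longleftrightarrow> M \<in> carrier_mat n n \<and> M\<^sup>T = M \<and>
     (\<forall>v\<in>carrier_vec n. v \<noteq> 0\<^sub>v n \<longrightarrow> 0 < scalar_prod v (M *\<^sub>v v))"

lemma symmetric_mat_scalar_prod:
  fixes S :: "'a::comm_ring_1 mat"
  assumes "S \<in> carrier_mat n n" "S\<^sup>T = S" "u \<in> carrier_vec n" "w \<in> carrier_vec n"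
  shows "scalar_prod u (S *\<^sub>v w) = scalar_prod w (S *\<^sub>v u)"
  using transpose_vec_mult_scalar[OF assms(1,4,3)] assms
  by (metis comm_scalar_prod mult_mat_vec_carrier)

lemma pos_def_mat_eq_0:
  assumes "pos_def_mat n M" "v \<in> carrier_vec n" "scalar_prod v (M *\<^sub>v v) \<le> 0"
  shows "v = 0\<^sub>v n"
  using assms by (force simp: pos_def_mat_def)

lemma pos_def_mat_det:
  assumes "pos_def_mat n M"
  shows "Determinant.det M \<noteq> 0"
proof
  assume "Determinant.det M = 0"
  then obtain v where v: "v \<in> carrier_vec n" "v \<noteq> 0\<^sub>v n" "M *\<^sub>v v = 0\<^sub>v n"
    using det_0_iff_vec_prod_zero_field[of M n] assms by (auto simp: pos_def_mat_def)
  then have "scalar_prod v (M *\<^sub>v v) = 0" by simp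
  with v assms show False by (auto simp: pos_def_mat_def)
qed

section \<open>Rank and nullity of a matrix\<close>

lemma module_hom_mult_mat_vec:
  fixes M :: "'a::field mat"
  assumes M: "M \<in> carrier_mat n m"
  shows "(\<lambda>v. M *\<^sub>v v) \<in> module_hom class_ring (module_vec TYPE('a) m) (module_vec TYPE('a) n)"
    unfolding module_hom_def
  proof (intro CollectI conjI allI impI funcsetI; (elim conjE)?)
    fix v :: "'a vec" assume "v \<in> carrier (module_vec TYPE('a) m)"
    then show "M *\<^sub>v v \<in> carrier (module_vec TYPE('a) n)"
      unfolding module_vec_simps by (rule mult_mat_vec_carrier[OF M])
  next
    fix v w :: "'a vec"  assume "v \<in> carrier (module_vec TYPE('a) m)" "w \<in> carrier (module_vec TYPE('a) m)"
    then show "M *\<^sub>v (v \<oplus>\<^bsub>module_vec TYPE('a) m\<^esub> w) = M *\<^sub>v v \<oplus>\<^bsub>module_vec TYPE('a) n\<^esub> M *\<^sub>v w"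
      unfolding module_vec_simps by (rule mult_add_distrib_mat_vec[OF M])
  next
    fix c :: 'a and v :: "'a vec" assume "v \<in> carrier (module_vec TYPE('a) m)"
    then show "M *\<^sub>v (c \<odot>\<^bsub>module_vec TYPE('a) m\<^esub> v) = c \<odot>\<^bsub>module_vec TYPE('a) n\<^esub> (M *\<^sub>v v)"
      unfolding module_vec_simps by (rule mult_mat_vec[OF M])
  qed

text \<open>Rank-nullity for the linear map \<open>\<lambda>v. M *\<^sub>v v\<close>: its image is
  the span of the columns, whose dimension is the rank by definition.\<close>

lemma rank_plus_kernel_dim:
  fixes M :: "'a::field mat"
  assumes M: "M \<in> carrier_mat n m"
  shows "vec_space.rank n M + kernel_dim M = m"
proof -
  let ?V = "module_vec TYPE('a) m" and ?W = "module_vec TYPE('a) n" and ?T = "\<lambda>v. M *\<^sub>v v"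
  interpret W: vec_space "TYPE('a)" n .
  have V: "vectorspace class_ring ?V" "vectorspace.fin_dim class_ring ?V"
      "vectorspace.dim class_ring ?V = m"
    by (rule vec_vs vec_space.fin_dim vec_space.dim_is_n)+
  have hom: "mod_hom class_ring ?V ?W ?T"
    by (intro mod_hom.intro mod_hom_axioms.intro module_hom_mult_mat_vec[OF M]
        W.module_axioms vectorspace.axioms(1)[OF V(1)])
  have T: "linear_map class_ring ?V ?W ?T"
    by (intro linear_map.intro V(1) W.vectorspace_axioms hom)
  have im: "mod_hom.im ?V ?T = W.span (set (cols M))"
  proof -
    have dims: "\<forall>w\<in>set (cols M). dim_vec w = n"
      using cols_dim[of M] M by (metis carrier_matD(1) carrier_vecD subsetD)
    have cols: "mat_of_cols n (cols M) = M" "length (cols M) = m"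
      using mat_of_cols_cols[of M] M by simp_all
    have lincomb: "W.lincomb_list c (cols M) = M *\<^sub>v vec m c" for c
      using W.lincomb_list_as_mat_mult[OF dims, of c] unfolding cols .
    \<comment> \<open>Every vector is \<open>vec m\<close> of its own entries, so the column
      combinations over all coefficient functions exhaust the image.\<close>
    have range: "carrier_vec m = range (vec m :: (nat \<Rightarrow> 'a) \<Rightarrow> 'a vec)"
    proof (intro Set.set_eqI iffI)
      fix v :: "'a vec" assume "v \<in> carrier_vec m"
      then have "v = vec m (\<lambda>i. vec_index v i)" by (intro eq_vecI) auto
      then show "v \<in> range (vec m)" by blast
    qed auto
    have "mod_hom.im ?V ?T = W.span_list (cols M)"
      unfolding mod_hom.im_def[OF hom] W.span_list_def module_vec_simps lincomb range
      by (simp add: full_SetCompr_eq image_image)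
    also have "\<dots> = W.span (set (cols M))"
      using dims by (intro W.span_list_as_span) (auto intro: carrier_vecI)
    finally show ?thesis .
  qed
  have ker: "mod_hom.ker ?V ?W ?T = mat_kernel M"
    using M unfolding mod_hom.ker_def[OF hom] mat_kernel_def module_vec_simps by simp
  show ?thesis
    using linear_map.rank_nullity[OF T V(2)] M
    unfolding im ker W.rank_def V(3) kernel_dim_def by simp
qed

section \<open>Diagonalization of a symmetric matrix relative to a positive definite one\<close>

text \<open>\<open>T\<close> is self-adjoint for the inner product given by \<open>C\<close>. Split
  an eigenvector into real part \<open>u\<close> and imaginary part \<open>w\<close>: the symmetry
  of \<open>G\<close> between \<open>u\<close> and \<open>w\<close> leaves \<open>Im a\<close> times
  the sum of the \<open>C\<close>-energies of \<open>u\<close> and \<open>w\<close>, which is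
  positive.\<close>

lemma eigenvalue_symmetric_pair_real:
  assumes C: "pos_def_mat n C" and G: "G \<in> carrier_mat n n" "G\<^sup>T = G"
    and T: "T \<in> carrier_mat n n" "C * T = G"
    and ev: "eigenvalue (map_mat complex_of_real T) a"
  shows "Im a = 0"
proof -
  have Cc: "C \<in> carrier_mat n n" using C by (simp add: pos_def_mat_def)
  let ?T = "map_mat complex_of_real T"
  obtain v where v: "v \<in> carrier_vec n" "v \<noteq> 0\<^sub>v n" "?T *\<^sub>v v = a \<cdot>\<^sub>v v"
    using ev T(1) by (auto simp: eigenvalue_def eigenvector_def)
  define u w where "u = map_vec Re v" and "w = map_vec Im v"
  have uw: "u \<in> carrier_vec n" "w \<in> carrier_vec n" using v(1) by (auto simp: u_def w_def)
  have Tu: "T *\<^sub>v u = Re a \<cdot>\<^sub>v u - Im a \<cdot>\<^sub>v w"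
    unfolding u_def map_vec_Re_mult[OF T(1) v(1), symmetric] v(3)
    using v(1) by (auto simp: w_def)
  have Tw: "T *\<^sub>v w = Im a \<cdot>\<^sub>v u + Re a \<cdot>\<^sub>v w"
    unfolding w_def map_vec_Im_mult[OF T(1) v(1), symmetric] v(3)
    using v(1) by (auto simp: u_def)
  have G_mult: "G *\<^sub>v x = C *\<^sub>v (T *\<^sub>v x)" if "x \<in> carrier_vec n" for x
    using that T Cc by (metis assoc_mult_mat_vec)
  have *: "scalar_prod u (C *\<^sub>v w) = scalar_prod w (C *\<^sub>v u)"
    using C uw by (intro symmetric_mat_scalar_prod) (auto simp: pos_def_mat_def)
  have "scalar_prod w (G *\<^sub>v u) = Re a * scalar_prod w (C *\<^sub>v u) - Im a * scalar_prod w (C *\<^sub>v w)"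
    unfolding G_mult[OF uw(1)] Tu using uw Cc
    by (simp add: mult_minus_distrib_mat_vec[OF Cc] mult_mat_vec[OF Cc]
        scalar_prod_minus_distrib[of _ n])
  moreover have "scalar_prod u (G *\<^sub>v w) = Im a * scalar_prod u (C *\<^sub>v u) + Re a * scalar_prod u (C *\<^sub>v w)"
    unfolding G_mult[OF uw(2)] Tw using uw Cc
    by (simp add: mult_add_distrib_mat_vec[OF Cc] mult_mat_vec[OF Cc]
        scalar_prod_add_distrib[of _ n])
  moreover have "scalar_prod u (G *\<^sub>v w) = scalar_prod w (G *\<^sub>v u)"
    using G uw by (intro symmetric_mat_scalar_prod)
  ultimately have 0: "Im a * (scalar_prod u (C *\<^sub>v u) + scalar_prod w (C *\<^sub>v w)) = 0"
    using * by (simp add: algebra_simps)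
  have ge: "scalar_prod x (C *\<^sub>v x) \<ge> 0" if "x \<in> carrier_vec n" for x
    using C that Cc by (cases "x = 0\<^sub>v n") (auto simp: pos_def_mat_def less_imp_le)
  have "u \<noteq> 0\<^sub>v n \<or> w \<noteq> 0\<^sub>v n"
    using v(1,2) unfolding u_def w_def by (auto simp: vec_eq_iff complex_eq_iff)
  then have "scalar_prod u (C *\<^sub>v u) + scalar_prod w (C *\<^sub>v w) > 0"
    using C uw ge[OF uw(1)] ge[OF uw(2)] unfolding pos_def_mat_def
    by (metis add_nonneg_pos add_pos_nonneg)
  with 0 show ?thesis by simp
qed

lemma map_poly_of_real_prod_list:
  "map_poly complex_of_real (\<Prod>r\<leftarrow>rs. [:- r, 1:]) = (\<Prod>r\<leftarrow>rs. [:- complex_of_real r, 1:])"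
proof -
  interpret map_poly_comm_ring_hom complex_of_real ..
  show ?thesis by (simp add: hom_prod_list o_def)
qed

text \<open>Over the complex numbers the polynomial splits, and its roots are eigenvalues, hence
  real. The factorization is then the image of a real one under an injective map. Splitting over the
  reals is what the existence of a real Jordan form requires.\<close>

lemma char_poly_splits_real:
  fixes T :: "real mat"
  assumes T: "T \<in> carrier_mat n n"
    and real: "\<And>a. eigenvalue (map_mat complex_of_real T) a \<Longrightarrow> Im a = 0"
  shows "\<exists>rs. char_poly T = (\<Prod>r\<leftarrow>rs. [:- r, 1:])"
proof -
  let ?T = "map_mat complex_of_real T"
  have Tc: "?T \<in> carrier_mat n n" using T by simp
  obtain as where as: "char_poly ?T = (\<Prod>a\<leftarrow>as. [:- a, 1:])"
    using char_poly_factorized[OF Tc] by auto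
  have "Im a = 0" if "a \<in> set as" for a
    using that real[of a] unfolding eigenvalue_root_char_poly[OF Tc] as
    by (force simp: poly_prod_list prod_list_zero_iff)
  then have "map (complex_of_real \<circ> Re) as = map id as"
    by (intro map_cong) (auto simp: complex_eq_iff)
  then have "(\<Prod>a\<leftarrow>as. [:- a, 1:]) = (\<Prod>a\<leftarrow>map (complex_of_real \<circ> Re) as. [:- a, 1:])"
    by simp
  then have "map_poly complex_of_real (char_poly T) = map_poly complex_of_real (\<Prod>r\<leftarrow>map Re as. [:- r, 1:])"
    unfolding of_real_hom.char_poly_hom[OF T, symmetric] as
    using map_poly_of_real_prod_list[of "map Re as"] by (simp add: o_def)
  then have "char_poly T = (\<Prod>r\<leftarrow>map Re as. [:- r, 1:])"
    by (simp add: poly_eq_iff coeff_map_poly)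
  then show ?thesis by blast
qed

text \<open>The inverse of \<open>C\<close> times \<open>G\<close> is self-adjoint for the inner
  product given by \<open>C\<close>. Its real Jordan form has only blocks of size 1, and multiplying
  the resulting similarity by \<open>C\<close> gives the factorization of \<open>G\<close>.\<close>

lemma simultaneous_diagonalization:
  assumes C: "pos_def_mat n C" and G: "G \<in> carrier_mat n n" "G\<^sup>T = G"
  obtains X Xi d where "X \<in> carrier_mat n n" "Xi \<in> carrier_mat n n"
    "X * Xi = 1\<^sub>m n" "Xi * X = 1\<^sub>m n" "G = C * X * mat_diag n d * Xi"
proof -
  have Cc: "C \<in> carrier_mat n n" using C by (simp add: pos_def_mat_def)
  obtain Ci where Ci: "Ci \<in> carrier_mat n n" "C * Ci = 1\<^sub>m n"
    using det_nonzero_inverse[OF Cc pos_def_mat_det[OF C]] by metis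
  define T where "T = Ci * G"
  have T: "T \<in> carrier_mat n n" using Ci G by (simp add: T_def)
  have CT: "C * T = G"
    using assoc_mult_mat[OF Cc Ci(1) G(1)] Ci(2) G(1) by (simp add: T_def)
  obtain rs where rs: "char_poly T = (\<Prod>r\<leftarrow>rs. [:- r, 1:])"
    using char_poly_splits_real[OF T eigenvalue_symmetric_pair_real[OF C G T CT]] by blast
  obtain n_as where jnf: "jordan_nf T n_as"
    using jordan_nf_exists[OF T rs] by blast
  have "n_as = map (Pair 1) (map snd n_as)"
  proof (rule jordan_nf_blocks_1[OF T jnf])
    fix e v assume v: "v \<in> carrier_vec n"
      and 0: "char_matrix T e *\<^sub>v (char_matrix T e *\<^sub>v v) = 0\<^sub>v n"
    define w where "w = char_matrix T e *\<^sub>v v"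
    have w: "w \<in> carrier_vec n" using char_matrix_closed[OF T] v unfolding w_def by (rule mult_mat_vec_carrier)
    have char: "char_matrix T e *\<^sub>v x = T *\<^sub>v x - e \<cdot>\<^sub>v x" if "x \<in> carrier_vec n" for x
      using that T by (auto simp: char_matrix_def add_mult_distrib_mat_vec[of _ n n])
    have C_char: "C *\<^sub>v (char_matrix T e *\<^sub>v x) = G *\<^sub>v x - e \<cdot>\<^sub>v (C *\<^sub>v x)"
      if "x \<in> carrier_vec n" for x
      using that T Cc CT unfolding char[OF that]
      by (simp add: mult_minus_distrib_mat_vec[OF Cc] mult_mat_vec[OF Cc]
          assoc_mult_mat_vec[OF Cc T, symmetric])
    \<comment> \<open>With \<open>N = char_matrix T e\<close>, the matrix \<open>C * N\<close>,
      which is \<open>G\<close> minus \<open>e\<close> times \<open>C\<close>, is symmetric. Hence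
      the \<open>C\<close>-energy of \<open>w = N v\<close> is the product of \<open>v\<close> with
      \<open>C N N v\<close>, which is 0 by assumption.\<close>
    have "scalar_prod w (C *\<^sub>v w) = scalar_prod w (G *\<^sub>v v) - e * scalar_prod w (C *\<^sub>v v)"
      unfolding C_char[OF v, folded w_def] using w v Cc G T
      by (simp add: scalar_prod_minus_distrib[of _ n])
    also have "\<dots> = scalar_prod v (G *\<^sub>v w) - e * scalar_prod v (C *\<^sub>v w)"
      using symmetric_mat_scalar_prod[OF G v w] symmetric_mat_scalar_prod[OF Cc _ v w] C
      by (simp add: pos_def_mat_def)
    also have "\<dots> = scalar_prod v (C *\<^sub>v (char_matrix T e *\<^sub>v w))"
      unfolding C_char[OF w] using w v Cc G T
      by (simp add: scalar_prod_minus_distrib[of _ n])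
    also have "\<dots> = 0"
      using 0 v Cc by (simp add: w_def scalar_prod_def)
    finally show "char_matrix T e *\<^sub>v v = 0\<^sub>v n"
      using pos_def_mat_eq_0[OF C w] by (simp add: w_def)
  qed
  then obtain as where as: "n_as = map (Pair 1) as" by blast
  have "similar_mat T (mat_diag (length as) (\<lambda>i. as ! i))"
    using jnf unfolding jordan_nf_def as jordan_matrix_blocks_1 by simp
  then obtain X Xi where "similar_mat_wit T (mat_diag (length as) (\<lambda>i. as ! i)) X Xi"
    by (auto simp: similar_mat_def)
  note wit = similar_mat_witD2[OF T this]
  have len: "length as = n" using wit(5) by (auto simp: mat_diag_def)
  have "G = C * (X * mat_diag n (\<lambda>i. as ! i) * Xi)" using CT wit(3) len by simp
  also have "\<dots> = C * X * mat_diag n (\<lambda>i. as ! i) * Xi"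
    using wit Cc len by (simp add: assoc_mult_mat[of _ n n _ n _ n])
  finally show ?thesis using that wit by blast
qed

section \<open>The saddle point pencil\<close>

text \<open>Gaussian elimination of the first block leaves the Schur complement
  \<open>C - k B Ai B'\<close>, which the diagonalization turns into \<open>C X (1 - k D) Xi\<close>
  with \<open>D = mat_diag m d\<close>. The field is arbitrary because the lemma is applied to
  complexified matrices.\<close>

lemma pencil_factorization:
  fixes A B C :: "'a::field mat"
  assumes A: "A \<in> carrier_mat n n" and Ai: "Ai \<in> carrier_mat n n" "A * Ai = 1\<^sub>m n"
    and B: "B \<in> carrier_mat m n" and B': "B' \<in> carrier_mat n m" and C: "C \<in> carrier_mat m m"
    and X: "X \<in> carrier_mat m m" "Xi \<in> carrier_mat m m" "X * Xi = 1\<^sub>m m"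
    and G: "B * Ai * B' = C * X * mat_diag m d * Xi"
  shows "four_block_mat A (k \<cdot>\<^sub>m B') B C =
    four_block_mat A (0\<^sub>m n m) B (C * X)
    * mat_diag (n + m) (\<lambda>i. if i < n then 1 else 1 - k * d (i - n))
    * four_block_mat (1\<^sub>m n) (k \<cdot>\<^sub>m (Ai * B')) (0\<^sub>m m n) Xi"
    (is "_ = ?L * ?E * ?R")
proof -
  let ?D = "mat_diag m (\<lambda>i. 1 - k * d i)"
  have CX: "C * X \<in> carrier_mat m m" and AB': "Ai * B' \<in> carrier_mat n m"
    using C X Ai B' by simp_all
  have D: "mat_diag m f \<in> carrier_mat m m" for f :: "nat \<Rightarrow> 'a" by simp
  have "?E = four_block_mat (1\<^sub>m n) (0\<^sub>m n m) (0\<^sub>m m n) ?D"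
    by (rule eq_matI) (auto simp: mat_diag_def)
  then have "?L * ?E = four_block_mat A (0\<^sub>m n m) B (C * X * ?D)"
    using A B CX
    by (simp add: mult_four_block_mat[of _ n n _ m _ m _ _ n _ m] left_mult_zero_mat[OF D]
        right_mult_zero_mat[OF CX])
  then have "?L * ?E * ?R = four_block_mat A (A * (k \<cdot>\<^sub>m (Ai * B'))) B
      (B * (k \<cdot>\<^sub>m (Ai * B')) + C * X * ?D * Xi)"
    using A B CX X D AB'
    by (simp add: mult_four_block_mat[of _ n n _ m _ m _ _ n _ m]
        right_mult_zero_mat[OF mult_carrier_mat[OF CX D]])
  moreover have "A * (k \<cdot>\<^sub>m (Ai * B')) = k \<cdot>\<^sub>m B'"
    using A Ai B' AB' by (simp add: mult_smult_distrib[OF A AB'] assoc_mult_mat[OF A Ai(1) B', symmetric])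
  \<comment> \<open>The second summand is the Schur complement; the first adds back what the
    elimination removed from \<open>C\<close>.\<close>
  moreover have "B * (k \<cdot>\<^sub>m (Ai * B')) + C * X * ?D * Xi = C"
  proof -
    have "?D = 1\<^sub>m m - k \<cdot>\<^sub>m mat_diag m d"
      by (rule eq_matI) (auto simp: mat_diag_def)
    then have "C * X * ?D = C * X - k \<cdot>\<^sub>m (C * X * mat_diag m d)"
      using mult_minus_distrib_mat[OF CX one_carrier_mat smult_carrier_mat[OF D]] CX
        mult_smult_distrib[OF CX D] right_mult_one_mat[OF CX] by simp
    then have "C * X * ?D * Xi = C * X * Xi - k \<cdot>\<^sub>m (C * X * mat_diag m d) * Xi"
      using minus_mult_distrib_mat[OF CX _ X(2), of "k \<cdot>\<^sub>m (C * X * mat_diag m d)"]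
        mult_carrier_mat[OF CX D] by simp
    also have "\<dots> = C - k \<cdot>\<^sub>m (B * Ai * B')"
      using X C mult_smult_assoc_mat[OF mult_carrier_mat[OF CX D] X(2)] unfolding G
      by (simp add: assoc_mult_mat[OF C X(1,2)])
    finally have "C * X * ?D * Xi = C - k \<cdot>\<^sub>m (B * Ai * B')" .
    moreover have "B * (k \<cdot>\<^sub>m (Ai * B')) = k \<cdot>\<^sub>m (B * Ai * B')"
      using B Ai B' AB' by (simp add: mult_smult_distrib[OF B AB'] assoc_mult_mat[OF B Ai(1) B'])
    ultimately show ?thesis
      using C B Ai(1) B' by (simp, intro eq_matI) auto
  qed
  ultimately show ?thesis by simp
qed

section \<open>Determinants, zero counts and root orders of linear factors\<close>

lemma det_mat_diag: "Determinant.det (mat_diag n f) = (\<Prod>i<n. f i)"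
proof -
  have "Determinant.det (mat_diag n f) = prod_list (diag_mat (mat_diag n f))"
    by (rule det_upper_triangular[of _ n]) (auto simp: mat_diag_def)
  also have "diag_mat (mat_diag n f) = map f [0..<n]"
    by (auto simp: diag_mat_def mat_diag_def)
  finally show ?thesis by (simp add: prod.distinct_set_conv_list[symmetric] lessThan_atLeast0)
qed

text \<open>Drops the \<open>n\<close> unit entries of the diagonal factor from its
  determinant.\<close>

lemma prod_shift:
  fixes n m :: nat
  shows "(\<Prod>i<n + m. if i < n then 1 else f (i - n)) = (\<Prod>i<m. f i :: 'a::comm_monoid_mult)"
  by (induction m) auto

text \<open>The analogue of \<open>prod_shift\<close> for counting the zero entries of the diagonal
  factor.\<close>

lemma card_shift: "card {i. i < n + m \<and> (if i < n then P else Q (i - n))}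
    = (if P then n else 0) + card {i. i < m \<and> Q i}" for n m :: nat
proof -
  have "{i. i < n + m \<and> (if i < n then P else Q (i - n))}
      = (if P then {..<n} else {}) \<union> (+) n ` {i. i < m \<and> Q i}"
    by (force simp: image_iff intro: exI[of _ "_ - n"])
  also have "card \<dots> = card (if P then {..<n} else {}) + card ((+) n ` {i. i < m \<and> Q i})"
    by (rule card_Un_disjoint) auto
  also have "card ((+) n ` {i. i < m \<and> Q i}) = card {i. i < m \<and> Q i}"
    by (rule card_image) simp
  finally show ?thesis by simp
qed

text \<open>Constant factors, \<open>b = 0\<close>, are covered because an entry
  \<open>d i = 0\<close> contributes the factor 1 to the pencil polynomial and thus no finite
  eigenvalue.\<close>

lemma order_pCons_linear:
  fixes a b :: "'a::field"
  assumes "a \<noteq> 0 \<or> b \<noteq> 0"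
  shows "Polynomial.order x [:a, b:] = (if a + x * b = 0 then 1 else 0)"
proof -
  have "[:a, b:] \<noteq> 0" using assms by auto
  then have "Polynomial.order x [:a, b:] \<le> 1" "Polynomial.order x [:a, b:] \<noteq> 0 \<longleftrightarrow> a + x * b = 0"
    using order_degree[of "[:a, b:]" x] order_root[of "[:a, b:]" x] by (auto split: if_splits)
  then show ?thesis by auto
qed

lemma order_prod_linear:
  fixes a b :: "nat \<Rightarrow> 'a::field"
  assumes "\<And>i. i < m \<Longrightarrow> a i \<noteq> 0 \<or> b i \<noteq> 0"
  shows "Polynomial.order x (\<Prod>i<m. [:a i, b i:]) = card {i. i < m \<and> a i + x * b i = 0}"
  using assms
proof (induction m)
  case (Suc m)
  have "{i. i < Suc m \<and> a i + x * b i = 0}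
      = (if a m + x * b m = 0 then insert m else id) {i. i < m \<and> a i + x * b i = 0}"
    by (auto simp: less_Suc_eq)
  moreover have "(\<Prod>i<m. [:a i, b i:]) * [:a m, b m:] \<noteq> 0"
    using Suc.prems unfolding mult_eq_0_iff by (auto simp: less_Suc_eq)
  then have "Polynomial.order x (\<Prod>i<Suc m. [:a i, b i:])
      = Polynomial.order x (\<Prod>i<m. [:a i, b i:]) + Polynomial.order x [:a m, b m:]"
    unfolding prod.lessThan_Suc by (rule Polynomial.order_mult)
  ultimately show ?case
    using Suc by (simp add: order_pCons_linear)
qed simp

text \<open>Evaluation at \<open>l\<close> is a ring homomorphism, so it commutes with the
  determinant.\<close>

lemma poly_pencil_poly:
  assumes "P \<in> carrier_mat n n" "Q \<in> carrier_mat n n"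
  shows "poly (pencil_poly P Q) l = Determinant.det (P - l \<cdot>\<^sub>m Q)"
proof -
  have "map_mat (\<lambda>p. poly p l) (map_mat (\<lambda>a. [:a:]) P - [:0, 1:] \<cdot>\<^sub>m map_mat (\<lambda>a. [:a:]) Q)
      = P - l \<cdot>\<^sub>m Q"
    using assms by (intro eq_matI) auto
  then show ?thesis
    unfolding pencil_poly_def by (metis comm_ring_hom.hom_det poly_hom.comm_ring_hom_axioms)
qed

text \<open>Multiplying the difference by the indeterminate repairs the missing point. The
  reciprocal pencil is computed through \<open>1 / x\<close>, hence only for
  \<open>x \<noteq> 0\<close>.\<close>

lemma poly_eq_if_eq_nonzero:
  fixes p q :: "'a::field_char_0 poly"
  assumes "\<And>x. x \<noteq> 0 \<Longrightarrow> poly p x = poly q x"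
  shows "p = q"
proof -
  have "poly ([:0, 1:] * (p - q)) x = 0" for x using assms[of x] by (cases "x = 0") auto
  then have "[:0, 1:] * (p - q) = 0" using poly_all_0_iff_0 by blast
  then show ?thesis by simp
qed

section \<open>Saddle point matrices with a positive definite form\<close>

text \<open>The expression in \<open>pos\<close> is the quadratic form of the full symmetric block
  matrix, with its two off-diagonal terms merged. These assumptions are the interface between the
  matrix algebra and the function spaces.\<close>

locale spd_saddle =
  fixes A B C :: "real mat" and n m :: nat
  assumes A: "A \<in> carrier_mat n n" and B: "B \<in> carrier_mat m n" and C: "C \<in> carrier_mat m m"
    and A_sym: "A\<^sup>T = A" and C_sym: "C\<^sup>T = C"
    and pos: "\<And>x y. x \<in> carrier_vec n \<Longrightarrow> y \<in> carrier_vec m \<Longrightarrow> x \<noteq> 0\<^sub>v n \<or> y \<noteq> 0\<^sub>v m \<Longrightarrow>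
      0 < scalar_prod x (A *\<^sub>v x) + 2 * scalar_prod y (B *\<^sub>v x) + scalar_prod y (C *\<^sub>v y)"
begin

lemma A_pos_def: "pos_def_mat n A"
  unfolding pos_def_mat_def
proof (intro conjI ballI impI A A_sym)
  fix x :: "real vec" assume "x \<in> carrier_vec n" "x \<noteq> 0\<^sub>v n"
  then show "0 < scalar_prod x (A *\<^sub>v x)"
    using pos[of x "0\<^sub>v m"] B C by simp
qed

lemma C_pos_def: "pos_def_mat m C"
  unfolding pos_def_mat_def
proof (intro conjI ballI impI C C_sym)
  fix y :: "real vec" assume "y \<in> carrier_vec m" "y \<noteq> 0\<^sub>v m"
  moreover have "B *\<^sub>v 0\<^sub>v n = 0\<^sub>v m" using B by (intro eq_vecI) (auto simp: scalar_prod_def)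
  ultimately show "0 < scalar_prod y (C *\<^sub>v y)"
    using pos[of "0\<^sub>v n" y] A C by simp
qed

lemma B'[simp]: "B\<^sup>T \<in> carrier_mat n m" using B by simp

text \<open>For \<open>G = B * Ai * B\<^sup>T\<close> the form of \<open>G\<close> at
  \<open>y\<close> is the \<open>A\<close>-energy of the vector obtained by applying
  \<open>Ai\<close> to \<open>B\<^sup>T *\<^sub>v y\<close>. So \<open>G\<close> is nonnegative and
  has the kernel of \<open>B\<^sup>T\<close>, while positivity of the block form bounds it strictly
  by \<open>C\<close>. The \<open>d i\<close> are Rayleigh quotients of \<open>G\<close> against
  \<open>C\<close>.\<close>

lemma diagonalization:
  obtains Ai X Xi d where
    "Ai \<in> carrier_mat n n" "A * Ai = 1\<^sub>m n"
    "X \<in> carrier_mat m m" "Xi \<in> carrier_mat m m" "X * Xi = 1\<^sub>m m" "Xi * X = 1\<^sub>m m"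
    "B * Ai * B\<^sup>T = C * X * mat_diag m d * Xi"
    "mat_kernel (B * Ai * B\<^sup>T) = mat_kernel B\<^sup>T"
    "\<And>i. i < m \<Longrightarrow> 0 \<le> d i \<and> d i < 1"
proof -
  obtain Ai where Ai: "Ai \<in> carrier_mat n n" "Ai * A = 1\<^sub>m n" "A * Ai = 1\<^sub>m n"
    using det_nonzero_inverse[OF A pos_def_mat_det[OF A_pos_def]] by metis
  have "Ai\<^sup>T * A = 1\<^sub>m n"
    using transpose_mult[OF A Ai(1)] Ai(3) A_sym by simp
  then have Ai_sym: "Ai\<^sup>T = Ai"
    using assoc_mult_mat[of "Ai\<^sup>T" n n A n Ai n] A Ai by simp
  define G where "G = B * Ai * B\<^sup>T"
  have BAi: "B * Ai \<in> carrier_mat m n" using B Ai by simp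
  have G: "G \<in> carrier_mat m m" unfolding G_def by (rule mult_carrier_mat[OF BAi B'])
  have G_sym: "G\<^sup>T = G"
    unfolding G_def using transpose_mult[OF BAi B'] transpose_mult[OF B Ai(1)] Ai_sym B Ai(1)
    by (simp add: assoc_mult_mat[of _ m n _ n _ m])
  have quad: "scalar_prod y (G *\<^sub>v y) = scalar_prod (Ai *\<^sub>v (B\<^sup>T *\<^sub>v y)) (A *\<^sub>v (Ai *\<^sub>v (B\<^sup>T *\<^sub>v y)))"
    "scalar_prod y (B *\<^sub>v (Ai *\<^sub>v (B\<^sup>T *\<^sub>v y))) = scalar_prod y (G *\<^sub>v y)"
    if y: "y \<in> carrier_vec m" for y
  proof -
    define z where "z = B\<^sup>T *\<^sub>v y"
    have z: "z \<in> carrier_vec n" using y B' by (auto simp: z_def)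
    have Az: "Ai *\<^sub>v z \<in> carrier_vec n" using Ai z by auto
    have *: "G *\<^sub>v y = B *\<^sub>v (Ai *\<^sub>v z)"
      unfolding G_def z_def using y B Ai by (simp add: assoc_mult_mat_vec[of _ m n _ m] assoc_mult_mat_vec[of _ m n _ n])
    then show "scalar_prod y (B *\<^sub>v (Ai *\<^sub>v (B\<^sup>T *\<^sub>v y))) = scalar_prod y (G *\<^sub>v y)"
      by (simp add: z_def)
    have "scalar_prod y (G *\<^sub>v y) = scalar_prod z (Ai *\<^sub>v z)"
      unfolding * using transpose_vec_mult_scalar[OF B Az y] by (simp add: z_def)
    moreover have "A *\<^sub>v (Ai *\<^sub>v z) = z"
      using assoc_mult_mat_vec[OF A Ai(1) z] Ai z by simp
    ultimately show "scalar_prod y (G *\<^sub>v y) = scalar_prod (Ai *\<^sub>v (B\<^sup>T *\<^sub>v y)) (A *\<^sub>v (Ai *\<^sub>v (B\<^sup>T *\<^sub>v y)))"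
      using comm_scalar_prod[OF z Az] by (simp add: z_def)
  qed
  have Ay: "Ai *\<^sub>v (B\<^sup>T *\<^sub>v y) \<in> carrier_vec n" if "y \<in> carrier_vec m" for y
    using that Ai B' by (meson mult_mat_vec_carrier)
  have G_nonneg: "0 \<le> scalar_prod y (G *\<^sub>v y)" if y: "y \<in> carrier_vec m" for y
    unfolding quad(1)[OF y] using A_pos_def pos_def_mat_eq_0[OF A_pos_def Ay[OF y]] A Ay[OF y]
    by (metis linear order_refl scalar_prod_left_zero mult_mat_vec_carrier)
  have G_less: "scalar_prod y (G *\<^sub>v y) < scalar_prod y (C *\<^sub>v y)"
    if y: "y \<in> carrier_vec m" "y \<noteq> 0\<^sub>v m" for y
  proof -
    let ?x = "Ai *\<^sub>v (B\<^sup>T *\<^sub>v y)"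
    have x: "?x \<in> carrier_vec n" by (rule Ay[OF y(1)])
    have Ax: "A *\<^sub>v ?x \<in> carrier_vec n" and Bx: "B *\<^sub>v ?x \<in> carrier_vec m"
      using A B x by (meson mult_mat_vec_carrier)+
    \<comment> \<open>For fixed \<open>y\<close> this choice of the first argument minimizes the
      block form, and the minimum is the form of \<open>C\<close> minus that of
      \<open>G\<close>.\<close>
    have "0 < scalar_prod ((-1) \<cdot>\<^sub>v ?x) (A *\<^sub>v ((-1) \<cdot>\<^sub>v ?x))
        + 2 * scalar_prod y (B *\<^sub>v ((-1) \<cdot>\<^sub>v ?x)) + scalar_prod y (C *\<^sub>v y)"
      using x y by (intro pos) auto
    then show ?thesis
      unfolding mult_mat_vec[OF A x] mult_mat_vec[OF B x]
      using quad[OF y(1)] x y(1) Ax Bx by simp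
  qed
  have ker: "mat_kernel G = mat_kernel B\<^sup>T"
  proof
    show "mat_kernel B\<^sup>T \<subseteq> mat_kernel G"
      unfolding G_def by (rule mat_kernel_mult_subset[OF B' BAi])
    show "mat_kernel G \<subseteq> mat_kernel B\<^sup>T"
    proof
      fix y assume "y \<in> mat_kernel G"
      then have y: "y \<in> carrier_vec m" "G *\<^sub>v y = 0\<^sub>v m" using G by (auto simp: mat_kernel_def)
      then have "scalar_prod (Ai *\<^sub>v (B\<^sup>T *\<^sub>v y)) (A *\<^sub>v (Ai *\<^sub>v (B\<^sup>T *\<^sub>v y))) = 0"
        using quad(1)[OF y(1)] by simp
      then have 0: "Ai *\<^sub>v (B\<^sup>T *\<^sub>v y) = 0\<^sub>v n"
        using pos_def_mat_eq_0[OF A_pos_def Ay[OF y(1)]] by simp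
      have By: "B\<^sup>T *\<^sub>v y \<in> carrier_vec n" using B' y(1) by (meson mult_mat_vec_carrier)
      have "B\<^sup>T *\<^sub>v y = A *\<^sub>v (Ai *\<^sub>v (B\<^sup>T *\<^sub>v y))"
        using assoc_mult_mat_vec[OF A Ai(1) By] Ai By by simp
      also have "\<dots> = 0\<^sub>v n" unfolding 0 using A by (intro eq_vecI) (auto simp: scalar_prod_def)
      finally show "y \<in> mat_kernel B\<^sup>T" using y B by (auto simp: mat_kernel_def)
    qed
  qed
  obtain X Xi d where X: "X \<in> carrier_mat m m" "Xi \<in> carrier_mat m m"
    "X * Xi = 1\<^sub>m m" "Xi * X = 1\<^sub>m m" "G = C * X * mat_diag m d * Xi"
    using simultaneous_diagonalization[OF C_pos_def G G_sym] by metis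
  have "0 \<le> d i \<and> d i < 1" if i: "i < m" for i
  proof -
    \<comment> \<open>Column \<open>i\<close> of \<open>X\<close> is a generalized eigenvector:
      \<open>G\<close> maps it to \<open>d i\<close> times its image under \<open>C\<close>.\<close>
    define x where "x = X *\<^sub>v unit_vec m i"
    have x: "x \<in> carrier_vec m" using X by (auto simp: x_def)
    have Xix: "Xi *\<^sub>v x = unit_vec m i"
      unfolding x_def using assoc_mult_mat_vec[OF X(2,1), of "unit_vec m i"] X(4) by simp
    have "x \<noteq> 0\<^sub>v m"
    proof
      assume "x = 0\<^sub>v m"
      then have "Xi *\<^sub>v x = 0\<^sub>v m" using X(2) by (auto intro!: eq_vecI simp: scalar_prod_def)
      then have "vec_index (unit_vec m i) i = (0::real)" unfolding Xix using i by simp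
      then show False using i by simp
    qed
    have CX: "C * X \<in> carrier_mat m m" using C X by simp
    have D: "mat_diag m d \<in> carrier_mat m m" by simp
    have "G *\<^sub>v x = C * X *\<^sub>v (mat_diag m d *\<^sub>v (Xi *\<^sub>v x))"
      unfolding X(5) using CX D X(2) x
      by (simp add: assoc_mult_mat_vec[of _ m m _ m])
    also have "mat_diag m d *\<^sub>v (Xi *\<^sub>v x) = d i \<cdot>\<^sub>v unit_vec m i"
      unfolding Xix using i by (intro eq_vecI) (auto simp: mat_diag_def scalar_prod_def unit_vec_def mult_delta_right)
    also have "C * X *\<^sub>v (d i \<cdot>\<^sub>v unit_vec m i) = d i \<cdot>\<^sub>v (C *\<^sub>v x)"
      using mult_mat_vec[OF CX, of "unit_vec m i" "d i"] assoc_mult_mat_vec[OF C X(1), of "unit_vec m i"]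
      by (simp add: x_def)
    finally have "scalar_prod x (G *\<^sub>v x) = d i * scalar_prod x (C *\<^sub>v x)"
      using x C by simp
    moreover have "0 < scalar_prod x (C *\<^sub>v x)"
      using C_pos_def x \<open>x \<noteq> 0\<^sub>v m\<close> by (simp add: pos_def_mat_def)
    moreover have "0 \<le> scalar_prod x (G *\<^sub>v x)" "scalar_prod x (G *\<^sub>v x) < scalar_prod x (C *\<^sub>v x)"
      using G_nonneg[OF x] G_less[OF x \<open>x \<noteq> 0\<^sub>v m\<close>] .
    ultimately show ?thesis
      by (metis less_eq_real_def linorder_not_less mult_less_cancel_right2 zero_le_mult_iff)
  qed
  then show ?thesis
    using that[OF Ai(1,3) X(1-4)] X(5) ker unfolding G_def by blast
qed

end

section \<open>Spectrum and multiplicities of the pencil\<close>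

lemma zero_mult_mat_vec:
  fixes x :: "'a::comm_semiring_0 vec"
  shows "x \<in> carrier_vec m \<Longrightarrow> 0\<^sub>m n m *\<^sub>v x = 0\<^sub>v n"
  by (intro eq_vecI) (auto simp: scalar_prod_def)

text \<open>Translates a zero of the diagonal factor into the finite eigenvalue that
  \<open>d\<close> produces.\<close>

lemma linear_factor_eq_0_iff:
  "1 - (1 + l) * complex_of_real d = 0 \<longleftrightarrow> d \<noteq> 0 \<and> complex_of_real (1 / d - 1) = l"
proof (cases "d = 0")
  case False
  have "1 - (1 + l) * complex_of_real d = 0 \<longleftrightarrow> (1 + l) * complex_of_real d = 1" by auto
  also have "\<dots> \<longleftrightarrow> 1 + l = 1 / complex_of_real d"
    using False by (subst nonzero_eq_divide_eq) auto
  also have "\<dots> \<longleftrightarrow> complex_of_real (1 / d - 1) = l"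
    unfolding of_real_diff of_real_divide of_real_1 by (metis add_diff_cancel_left' diff_add_cancel add.commute)
  finally show ?thesis using False by simp
qed simp

text \<open>Several indices may give the same eigenvalue; the fibres of \<open>f\<close> are its
  multiplicities.\<close>

lemma sum_card_fibres:
  assumes "finite A"
  shows "(\<Sum>l\<in>f ` A. card {i \<in> A. f i = l}) = card A"
  using sum.image_gen[OF assms, of "\<lambda>_. 1 :: nat" f] by simp

context spd_saddle
begin

definition P where "P = map_mat complex_of_real (four_block_mat A B\<^sup>T B C)"
definition Q where "Q = map_mat complex_of_real
  (four_block_mat (0\<^sub>m n n) (- B\<^sup>T) (0\<^sub>m m n) (0\<^sub>m m m))"

lemma P_carrier: "P \<in> carrier_mat (n + m) (n + m)"
  using A C by (simp add: P_def)

lemma Q_carrier: "Q \<in> carrier_mat (n + m) (n + m)"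
  by (simp add: Q_def)

text \<open>\<open>Q\<close> sends \<open>x @\<^sub>v y\<close> to minus the transpose of
  \<open>B\<close> applied to \<open>y\<close>, followed by zeros, so \<open>x\<close> is free. This
  freedom is the first family of infinite eigenvalues.\<close>

lemma mat_kernel_Q:
  "mat_kernel Q = {x @\<^sub>v y | x y. x \<in> carrier_vec n \<and> y \<in> mat_kernel (map_mat complex_of_real B\<^sup>T)}"
proof -
  let ?B = "map_mat complex_of_real B\<^sup>T"
  have B: "?B \<in> carrier_mat n m" using B by simp
  have Q: "Q = four_block_mat (0\<^sub>m n n) (- ?B) (0\<^sub>m m n) (0\<^sub>m m m)"
    unfolding Q_def four_block_mat_def Let_def using spd_saddle.B[OF spd_saddle_axioms]
    by (intro eq_matI) auto
  have *: "Q *\<^sub>v (x @\<^sub>v y) = - (?B *\<^sub>v y) @\<^sub>v 0\<^sub>v m" if "x \<in> carrier_vec n" "y \<in> carrier_vec m" for x y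
    unfolding Q using B that by (subst four_block_mat_mult_vec[of _ n n _ m _ m]) auto
  show ?thesis
  proof (intro Set.set_eqI iffI)
    fix z assume z: "z \<in> mat_kernel Q"
    define x y where "x = vec_first z n" and "y = vec_last z m"
    have "z \<in> carrier_vec (n + m)" using z Q_carrier by (simp add: mat_kernel_def)
    then have xy: "z = x @\<^sub>v y" "x \<in> carrier_vec n" "y \<in> carrier_vec m"
      by (auto simp: x_def y_def)
    have "- (?B *\<^sub>v y) @\<^sub>v 0\<^sub>v m = 0\<^sub>v n @\<^sub>v (0\<^sub>v m :: complex vec)"
      using z *[OF xy(2,3)] Q_carrier unfolding xy(1) by (auto simp: mat_kernel_def)
    then have "- (?B *\<^sub>v y) = 0\<^sub>v n"
      using B xy(3) append_vec_eq[of "- (?B *\<^sub>v y)" n "0\<^sub>v n"] by auto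
    then have "?B *\<^sub>v y = 0\<^sub>v n"
      using B xy(3) by (metis mult_mat_vec_carrier uminus_eq_vec uminus_zero_vec uminus_uminus_vec)
    then have "y \<in> mat_kernel ?B" using xy(3) B by (auto simp: mat_kernel_def)
    then show "z \<in> {x @\<^sub>v y | x y. x \<in> carrier_vec n \<and> y \<in> mat_kernel ?B}"
      using xy by blast
  next
    fix z assume "z \<in> {x @\<^sub>v y | x y. x \<in> carrier_vec n \<and> y \<in> mat_kernel ?B}"
    then obtain x y where xy: "z = x @\<^sub>v y" "x \<in> carrier_vec n" "y \<in> mat_kernel ?B" by blast
    then have y: "y \<in> carrier_vec m" "?B *\<^sub>v y = 0\<^sub>v n" using mat_kernelD[OF B] by blast+
    have "Q *\<^sub>v z = 0\<^sub>v (n + m)"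
      unfolding xy(1) *[OF xy(2) y(1)] y(2) by (intro eq_vecI) auto
    then show "z \<in> mat_kernel Q"
      using xy(1,2) y(1) by (intro mat_kernelI[OF Q_carrier]) auto
  qed
qed

text \<open>In the factorization \<open>L * E l * R l\<close> the factor \<open>L\<close> is fixed
  and the determinant of \<open>R l\<close> is that of \<open>Xi\<close>, both being nonsingular.
  Determinant and kernel dimension of the pencil are therefore read off the diagonal factor
  \<open>E l\<close>.\<close>

lemma spectral_data:
  obtains d :: "nat \<Rightarrow> real" and c :: complex where
    "\<And>i. i < m \<Longrightarrow> 0 \<le> d i \<and> d i < 1" "c \<noteq> 0"
    "\<And>l. Determinant.det (P - l \<cdot>\<^sub>m Q) = c * (\<Prod>i<m. 1 - (1 + l) * d i)"
    "\<And>l. kernel_dim (P - l \<cdot>\<^sub>m Q) = card {i. i < m \<and> 1 - (1 + l) * d i = 0}"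
    "kernel_dim B\<^sup>T = card {i. i < m \<and> d i = 0}"
    "kernel_dim Q = n + card {i. i < m \<and> d i = 0}"
proof -
  let ?h = "map_mat complex_of_real"
  obtain Ai X Xi d where Ai: "Ai \<in> carrier_mat n n" "A * Ai = 1\<^sub>m n"
    and X: "X \<in> carrier_mat m m" "Xi \<in> carrier_mat m m" "X * Xi = 1\<^sub>m m" "Xi * X = 1\<^sub>m m"
    and G: "B * Ai * B\<^sup>T = C * X * mat_diag m d * Xi"
    and ker: "mat_kernel (B * Ai * B\<^sup>T) = mat_kernel B\<^sup>T"
    and d: "\<And>i. i < m \<Longrightarrow> 0 \<le> d i \<and> d i < 1"
    using diagonalization by metis
  note hom_mult = of_real_hom.mat_hom_mult
  have CX: "C * X \<in> carrier_mat m m" and BAi: "B * Ai \<in> carrier_mat m n"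
    and BAiB: "B * Ai * B\<^sup>T \<in> carrier_mat m m"
    using B B' C Ai X by (auto intro!: mult_carrier_mat)
  have D: "mat_diag m f \<in> carrier_mat m m" for f :: "nat \<Rightarrow> 'b::zero" by simp
  have hD: "?h (mat_diag m d) = mat_diag m (\<lambda>i. complex_of_real (d i))"
    by (rule eq_matI) (auto simp: mat_diag_def)
  have hB': "?h B\<^sup>T \<in> carrier_mat n m" using B by simp
  have hAi: "?h A * ?h Ai = 1\<^sub>m n"
    using hom_mult[OF A Ai(1)] unfolding Ai(2) of_real_hom.mat_hom_one by (rule sym)
  have hX: "?h X * ?h Xi = 1\<^sub>m m"
    using hom_mult[OF X(1,2)] unfolding X(3) of_real_hom.mat_hom_one by (rule sym)
  have hG: "?h B * ?h Ai * ?h B\<^sup>T = ?h C * ?h X * mat_diag m (\<lambda>i. complex_of_real (d i)) * ?h Xi"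
    using arg_cong[OF G, of ?h]
    by (simp add: hom_mult[OF BAi B'] hom_mult[OF B Ai(1)] hom_mult[OF mult_carrier_mat[OF CX D] X(2)]
        hom_mult[OF CX D] hom_mult[OF C X(1)] hD)
  define L where "L = four_block_mat (?h A) (0\<^sub>m n m) (?h B) (?h C * ?h X)"
  define E where "E l = mat_diag (n + m) (\<lambda>i. if i < n then 1 else 1 - (1 + l) * complex_of_real (d (i - n)))" for l
  define R where "R l = four_block_mat (1\<^sub>m n) ((1 + l) \<cdot>\<^sub>m (?h Ai * ?h B\<^sup>T)) (0\<^sub>m m n) (?h Xi)" for l
  have LR: "L \<in> carrier_mat (n + m) (n + m)" "E l \<in> carrier_mat (n + m) (n + m)"
    "R l \<in> carrier_mat (n + m) (n + m)" for l
    using A C X by (auto simp: L_def E_def R_def)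
  have LER: "P - l \<cdot>\<^sub>m Q = L * E l * R l" for l
  proof -
    \<comment> \<open>The upper right block of \<open>Q\<close> is \<open>- B\<^sup>T\<close>, which
      is why the elimination is used with \<open>k = 1 + l\<close>.\<close>
    have "P - l \<cdot>\<^sub>m Q = four_block_mat (?h A) ((1 + l) \<cdot>\<^sub>m ?h B\<^sup>T) (?h B) (?h C)"
      using A B C unfolding P_def Q_def four_block_mat_def Let_def
      by (intro eq_matI) (auto simp: algebra_simps)
    also have "\<dots> = L * E l * R l"
      unfolding L_def E_def R_def
      using A B C X Ai by (intro pencil_factorization[OF _ _ hAi _ hB' _ _ _ hX hG]) auto
    finally show ?thesis .
  qed
  have det_prod: "Determinant.det A * Determinant.det Ai \<noteq> 0" "Determinant.det X * Determinant.det Xi \<noteq> 0"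
    using det_mult[OF A Ai(1)] det_mult[OF X(1,2)] Ai X by simp_all
  have detL: "Determinant.det L = complex_of_real (Determinant.det A * (Determinant.det C * Determinant.det X))"
    unfolding L_def using A B C X
    by (subst det_four_block_mat_upper_right_zero[of _ n _ m]) (auto simp: det_mult[of _ m])
  have detR: "Determinant.det (R l) = complex_of_real (Determinant.det Xi)" for l
    unfolding R_def using X Ai B
    by (subst det_four_block_mat_lower_left_zero[of _ n _ m]) auto
  have nz: "Determinant.det L \<noteq> 0" "Determinant.det (R l) \<noteq> 0" for l
    unfolding detL detR using det_prod pos_def_mat_det[OF C_pos_def] by auto
  define c where "c = Determinant.det L * complex_of_real (Determinant.det Xi)"
  have "c \<noteq> 0" using nz(1) nz(2)[of 0] by (simp add: c_def detR)
  moreover have "Determinant.det (P - l \<cdot>\<^sub>m Q) = c * (\<Prod>i<m. 1 - (1 + l) * d i)" for l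
  proof -
    have "Determinant.det (L * E l * R l) = Determinant.det L * Determinant.det (E l) * Determinant.det (R l)"
      using LR by (simp add: det_mult[of _ "n + m"])
    then show ?thesis
      unfolding LER E_def det_mat_diag detR c_def
      by (simp add: prod_shift[of n "\<lambda>i. 1 - (1 + l) * complex_of_real (d i)"] mult_ac)
  qed
  moreover have "kernel_dim (P - l \<cdot>\<^sub>m Q) = card {i. i < m \<and> 1 - (1 + l) * d i = 0}" for l
  proof -
    have "kernel_dim (P - l \<cdot>\<^sub>m Q) = kernel_dim (E l)"
      unfolding LER by (rule kernel_dim_mult_invertible[OF LR nz])
    \<comment> \<open>The first \<open>n\<close> diagonal entries are 1 and never vanish, hence
      \<open>False\<close>.\<close>
    also have "\<dots> = card {i. i < n + m \<and> (if i < n then False else 1 - (1 + l) * d (i - n) = 0)}"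
      unfolding E_def kernel_dim_mat_diag by (rule arg_cong[of _ _ card]) auto
    finally show ?thesis
      unfolding card_shift[where P = False and Q = "\<lambda>i. 1 - (1 + l) * d i = 0"] by simp
  qed
  moreover have "kernel_dim B\<^sup>T = card {i. i < m \<and> d i = 0}"
  proof -
    have "kernel_dim B\<^sup>T = kernel_dim (B * Ai * B\<^sup>T)"
      unfolding kernel_dim_def using ker B BAiB by simp
    also have "\<dots> = kernel_dim (mat_diag m d)"
      unfolding G using CX X det_prod pos_def_mat_det[OF C_pos_def] C
      by (intro kernel_dim_mult_invertible[of _ m]) (auto simp: det_mult[OF C])
    finally show ?thesis by (simp add: kernel_dim_mat_diag)
  qed
  moreover have "kernel_dim Q = n + card {i. i < m \<and> d i = 0}"
  proof -
    \<comment> \<open>\<open>Q\<close> has the same kernel as the block diagonal matrix with blocks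
      0 and \<open>?G\<close>, and kernel dimensions add over diagonal blocks.\<close>
    let ?G = "?h (B * Ai * B\<^sup>T)"
    let ?W = "four_block_mat (0\<^sub>m n n) (0\<^sub>m n m) (0\<^sub>m m n) ?G"
    have hGc: "?G \<in> carrier_mat m m" using BAiB by simp
    have kerG: "mat_kernel ?G = mat_kernel (?h B\<^sup>T)"
      using mat_kernel_of_real_iff[OF BAiB] mat_kernel_of_real_iff[OF B'] ker
        mat_kernel_carrier[OF hGc] mat_kernel_carrier[OF hB'] by blast
    have "mat_kernel ?W = mat_kernel Q"
    proof -
      have W: "?W \<in> carrier_mat (n + m) (n + m)" using hGc by simp
      have *: "x @\<^sub>v y \<in> mat_kernel ?W \<longleftrightarrow> y \<in> mat_kernel ?G" if "x \<in> carrier_vec n" "y \<in> carrier_vec m" for x y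
      proof -
        have "?W *\<^sub>v (x @\<^sub>v y) = 0\<^sub>v n @\<^sub>v (?G *\<^sub>v y)"
          using mult_mat_vec_split[OF zero_carrier_mat hGc that] that zero_mult_mat_vec[of x n n] by simp
        moreover have "?G *\<^sub>v y \<in> carrier_vec m" using hGc that by (meson mult_mat_vec_carrier)
        moreover have "0\<^sub>v (n + m) = 0\<^sub>v n @\<^sub>v (0\<^sub>v m :: complex vec)" by (intro eq_vecI) auto
        ultimately show ?thesis
          using that append_vec_eq[of "0\<^sub>v n" n "0\<^sub>v n" "?G *\<^sub>v y" "0\<^sub>v m"]
          unfolding mat_kernel[OF W] mat_kernel[OF hGc] by simp
      qed
      show ?thesis
        unfolding mat_kernel_Q kerG[symmetric]
      proof (intro Set.set_eqI iffI)
        fix z assume z: "z \<in> mat_kernel ?W"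
        then have "z \<in> carrier_vec (n + m)" using mat_kernel_carrier[OF W] by blast
        then have "z = vec_first z n @\<^sub>v vec_last z m" by simp
        then show "z \<in> {x @\<^sub>v y | x y. x \<in> carrier_vec n \<and> y \<in> mat_kernel ?G}"
          using z * by (metis (mono_tags, lifting) mem_Collect_eq vec_first_carrier vec_last_carrier)
      next
        fix z assume "z \<in> {x @\<^sub>v y | x y. x \<in> carrier_vec n \<and> y \<in> mat_kernel ?G}"
        then show "z \<in> mat_kernel ?W" using * mat_kernel_carrier[OF hGc] by blast
      qed
    qed
    then have "kernel_dim Q = kernel.dim (n + m) ?W"
      using Q_carrier by (simp add: kernel_dim_def)
    also have "\<dots> = kernel.dim n (0\<^sub>m n n :: complex mat) + kernel.dim m ?G"
      by (rule kernel_four_block_0_mat[OF refl zero_carrier_mat hGc])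
    also have "kernel.dim n (0\<^sub>m n n :: complex mat) = n"
    proof -
      have "0\<^sub>m n n = (mat_diag n (\<lambda>_. 0) :: complex mat)" by (rule eq_matI) (auto simp: mat_diag_def)
      then have "kernel_dim (0\<^sub>m n n :: complex mat) = n" by (simp add: kernel_dim_mat_diag)
      then show ?thesis by (simp add: kernel_dim_def)
    qed
    also have "kernel.dim m ?G = card {i. i < m \<and> d i = 0}"
    proof -
      have eq: "?G = ?h (C * X) * ?h (mat_diag m d) * ?h Xi"
        unfolding G by (simp add: hom_mult[OF mult_carrier_mat[OF CX D] X(2)] hom_mult[OF CX D])
      have "kernel_dim ?G = kernel_dim (?h (mat_diag m d))"
        unfolding eq using CX X det_prod pos_def_mat_det[OF C_pos_def] C
        by (intro kernel_dim_mult_invertible[of _ m]) (auto simp: det_mult[OF C])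
      also have "\<dots> = card {i. i < m \<and> d i = 0}"
        unfolding hD kernel_dim_mat_diag by simp
      finally show ?thesis unfolding kernel_dim_def carrier_matD(2)[OF hGc] .
    qed
    finally show ?thesis .
  qed
  ultimately show ?thesis using d by (intro that[of d c])
qed

text \<open>Each \<open>d i = 0\<close> joins the \<open>n\<close> unrestricted directions at
  infinity, and each other \<open>d i\<close> gives one finite eigenvalue. By rank-nullity the
  number of the latter is the rank of \<open>B\<^sup>T\<close>.\<close>

theorem saddle_pencil:
  "invertible_mat P"
  "geom_mult P Q Infty = n + kernel_dim B\<^sup>T"
  "alg_mult P Q Infty = n + kernel_dim B\<^sup>T"
  "gen_eigenvalue P Q (Fin l) \<Longrightarrow> \<exists>r>0. l = complex_of_real r"
  "finite {l. gen_eigenvalue P Q (Fin l)}"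
  "(\<Sum>l | gen_eigenvalue P Q (Fin l). geom_mult P Q (Fin l)) = vec_space.rank n B\<^sup>T"
  "(\<Sum>l | gen_eigenvalue P Q (Fin l). alg_mult P Q (Fin l)) = vec_space.rank n B\<^sup>T"
proof -
  obtain d :: "nat \<Rightarrow> real" and c :: complex where
    d: "\<And>i. i < m \<Longrightarrow> 0 \<le> d i \<and> d i < 1" and c: "c \<noteq> 0"
    and det: "\<And>l. Determinant.det (P - l \<cdot>\<^sub>m Q) = c * (\<Prod>i<m. 1 - (1 + l) * d i)"
    and kdim: "\<And>l. kernel_dim (P - l \<cdot>\<^sub>m Q) = card {i. i < m \<and> 1 - (1 + l) * d i = 0}"
    and ker_B': "kernel_dim B\<^sup>T = card {i. i < m \<and> d i = 0}"
    and ker_Q: "kernel_dim Q = n + card {i. i < m \<and> d i = 0}"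
    by (rule spectral_data) (rule that)
  have PQ: "P - l \<cdot>\<^sub>m Q \<in> carrier_mat (n + m) (n + m)" for l
    by (intro minus_carrier_mat smult_carrier_mat Q_carrier)
  \<comment> \<open>Invertibility of \<open>P\<close> is the case \<open>l = 0\<close> of the
    determinant formula, where \<open>d i < 1\<close> keeps every factor nonzero.\<close>
  have "P - 0 \<cdot>\<^sub>m Q = P" using P_carrier Q_carrier by (intro eq_matI) auto
  then have "Determinant.det P = c * (\<Prod>i<m. 1 - complex_of_real (d i))"
    using det[of 0] by simp
  moreover have "1 - complex_of_real (d i) \<noteq> 0" if "i < m" for i
    using d[OF that] by (metis eq_iff_diff_eq_0 less_irrefl of_real_1 of_real_eq_iff)
  ultimately have "Determinant.det P \<noteq> 0" using c by simp
  then obtain Pi where "Pi \<in> carrier_mat (n + m) (n + m)" "Pi * P = 1\<^sub>m (n + m)" "P * Pi = 1\<^sub>m (n + m)"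
    using det_nonzero_inverse[OF P_carrier] by metis
  then show "invertible_mat P"
    using P_carrier by (auto simp: invertible_mat_def inverts_mat_def)

  show "geom_mult P Q Infty = n + kernel_dim B\<^sup>T" using ker_Q ker_B' by simp

  have pencil_PQ: "pencil_poly P Q = Polynomial.smult c (\<Prod>i<m. [:1 - complex_of_real (d i), - complex_of_real (d i):])"
    by (rule poly_eq_if_eq_nonzero)
      (simp add: poly_pencil_poly[OF P_carrier Q_carrier] det poly_prod algebra_simps)
  \<comment> \<open>From \<open>Q - x P = -x (P - (1 / x) Q)\<close> for \<open>x \<noteq> 0\<close>; the factor is written \<open>[:-0, 1:]\<close> to
    match \<open>order_power_n_n\<close>.\<close>
  have pencil_QP: "pencil_poly Q P = Polynomial.smult ((-1) ^ (n + m) * c)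
      ([:-0, 1:] ^ n * (\<Prod>i<m. [:- complex_of_real (d i), 1 - complex_of_real (d i):]))"
  proof (rule poly_eq_if_eq_nonzero)
    fix x :: complex assume x: "x \<noteq> 0"
    have "Q - x \<cdot>\<^sub>m P = (-x) \<cdot>\<^sub>m (P - (1 / x) \<cdot>\<^sub>m Q)"
      using P_carrier Q_carrier x by (intro eq_matI) (auto simp: algebra_simps)
    then have "Determinant.det (Q - x \<cdot>\<^sub>m P) = (-x) ^ (n + m) * (c * (\<Prod>i<m. 1 - (1 + 1 / x) * d i))"
      using det[of "1 / x"] P_carrier Q_carrier by simp
    \<comment> \<open>Of the \<open>n + m\<close> powers of \<open>x\<close>, \<open>m\<close> are
      spread over the linear factors to clear \<open>1 / x\<close>. The other \<open>n\<close> form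
      the root 0 of order \<open>n\<close>.\<close>
    also have "\<dots> = (-1) ^ (n + m) * c * x ^ n * (x ^ m * (\<Prod>i<m. 1 - (1 + 1 / x) * d i))"
      by (simp add: power_add power_minus[of x] mult_ac)
    also have "x ^ m * (\<Prod>i<m. 1 - (1 + 1 / x) * d i) = (\<Prod>i<m. x * (1 - (1 + 1 / x) * d i))"
      by (simp add: prod.distrib)
    also have "\<dots> = (\<Prod>i<m. - d i + x * (1 - d i))"
      using x by (intro prod.cong) (auto simp: field_simps)
    finally show "poly (pencil_poly Q P) x = poly (Polynomial.smult ((-1) ^ (n + m) * c)
      ([:-0, 1:] ^ n * (\<Prod>i<m. [:- complex_of_real (d i), 1 - complex_of_real (d i):]))) x"
      by (simp add: poly_pencil_poly[OF Q_carrier P_carrier] poly_prod)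
  qed
  show "alg_mult P Q Infty = n + kernel_dim B\<^sup>T"
  proof -
    have "[:-0, 1:] ^ n * (\<Prod>i<m. [:- complex_of_real (d i), 1 - complex_of_real (d i):]) \<noteq> 0"
      by (auto simp: pCons_eq_0_iff)
    then have "Polynomial.order 0 ([:-0, 1:] ^ n * (\<Prod>i<m. [:- complex_of_real (d i), 1 - complex_of_real (d i):]))
        = Polynomial.order 0 ([:-0, 1 :: complex:] ^ n)
          + Polynomial.order 0 (\<Prod>i<m. [:- complex_of_real (d i), 1 - complex_of_real (d i):])"
      by (rule Polynomial.order_mult)
    also have "\<dots> = n + card {i. i < m \<and> d i = 0}"
      unfolding order_power_n_n by (subst order_prod_linear) auto
    finally show ?thesis using c by (simp add: pencil_QP Polynomial.order_smult ker_B')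
  qed

  have order: "alg_mult P Q (Fin l) = geom_mult P Q (Fin l)" for l
  proof -
    have "alg_mult P Q (Fin l) = card {i. i < m \<and> 1 - complex_of_real (d i) + l * - complex_of_real (d i) = 0}"
      using c by (simp add: pencil_PQ Polynomial.order_smult, subst order_prod_linear) (auto simp: algebra_simps)
    then show ?thesis by (simp add: kdim algebra_simps)
  qed

  have ev: "gen_eigenvalue P Q (Fin l) \<longleftrightarrow> (\<exists>i<m. d i \<noteq> 0 \<and> l = complex_of_real (1 / d i - 1))" for l
  proof -
    have "gen_eigenvalue P Q (Fin l) \<longleftrightarrow> Determinant.det (P - l \<cdot>\<^sub>m Q) = 0"
      unfolding det_0_iff_vec_prod_zero_field[OF PQ] gen_eigenvalue_def gen_eigenspace.simps
        mat_kernel[OF PQ] carrier_matD(2)[OF P_carrier] by blast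
    also have "\<dots> \<longleftrightarrow> (\<exists>i<m. 1 - (1 + l) * complex_of_real (d i) = 0)"
      using c by (auto simp: det)
    also have "\<dots> \<longleftrightarrow> (\<exists>i<m. d i \<noteq> 0 \<and> l = complex_of_real (1 / d i - 1))"
      unfolding linear_factor_eq_0_iff by blast
    finally show ?thesis .
  qed
  show "\<exists>r>0. l = complex_of_real r" if l: "gen_eigenvalue P Q (Fin l)"
  proof -
    obtain i where i: "i < m" "d i \<noteq> 0" "l = complex_of_real (1 / d i - 1)" using iffD1[OF ev l] by auto
    then have "0 < 1 / d i - 1" using d[OF i(1)] by simp
    then show ?thesis using i(3) by blast
  qed
  let ?ev = "{l. gen_eigenvalue P Q (Fin l)}"
  have ev_image: "?ev = (\<lambda>i. complex_of_real (1 / d i - 1)) ` {i. i < m \<and> d i \<noteq> 0}"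
    unfolding image_def ev by auto
  show fin: "finite ?ev" unfolding ev_image by simp
  \<comment> \<open>The multiplicity of \<open>l\<close> is the number of indices whose
    \<open>d i\<close> yields \<open>l\<close>, so the sum counts all \<open>i\<close> with
    \<open>d i \<noteq> 0\<close>.\<close>
  have "(\<Sum>l\<in>?ev. geom_mult P Q (Fin l)) = (\<Sum>l\<in>?ev. card {i \<in> {i. i < m \<and> d i \<noteq> 0}. complex_of_real (1 / d i - 1) = l})"
    unfolding geom_mult.simps kdim linear_factor_eq_0_iff by (simp add: conj_assoc)
  also have "\<dots> = card {i. i < m \<and> d i \<noteq> 0}"
    unfolding ev_image by (rule sum_card_fibres) simp
  also have "\<dots> = m - card {i. i < m \<and> d i = 0}"
  proof -
    have "{i. i < m \<and> d i \<noteq> 0} = {..<m} - {i. i < m \<and> d i = 0}" by auto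
    then show ?thesis by (simp only:, subst card_Diff_subset) auto
  qed
  also have "\<dots> = vec_space.rank n B\<^sup>T"
    using rank_plus_kernel_dim[OF B'] ker_B' by simp
  finally show geom: "(\<Sum>l\<in>?ev. geom_mult P Q (Fin l)) = vec_space.rank n B\<^sup>T" .
  then show "(\<Sum>l\<in>?ev. alg_mult P Q (Fin l)) = vec_space.rank n B\<^sup>T"
    unfolding order .
qed

end

section \<open>Positive definiteness of the Galerkin matrix\<close>

lemma L2_inner_integrable:
  assumes "f \<in> L2 \<Omega>" "g \<in> L2 \<Omega>"
  shows "integrable (lebesgue_on \<Omega>) (\<lambda>x. inner (f x) (g x))"
proof (rule Bochner_Integration.integrable_bound)
  show "integrable (lebesgue_on \<Omega>) (\<lambda>x. (norm (f x))\<^sup>2 + (norm (g x))\<^sup>2)"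
    using assms by (auto simp: L2_def)
  show "(\<lambda>x. inner (f x) (g x)) \<in> borel_measurable (lebesgue_on \<Omega>)"
    using assms by (auto simp: L2_def)
  have "norm (inner v w) \<le> norm ((norm v)\<^sup>2 + (norm w)\<^sup>2)" for v w :: 'b
  proof -
    have "\<bar>inner v w\<bar> \<le> norm v * norm w" by (rule Cauchy_Schwarz_ineq2)
    moreover have "2 * (norm v * norm w) \<le> (norm v)\<^sup>2 + (norm w)\<^sup>2"
      using sum_squares_bound[of "norm v" "norm w"] by simp
    moreover have "0 \<le> norm v * norm w" by simp
    ultimately show ?thesis by (simp add: power2_eq_square)
  qed
  then show "AE x in lebesgue_on \<Omega>. norm (inner (f x) (g x)) \<le> norm ((norm (f x))\<^sup>2 + (norm (g x))\<^sup>2)"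
    by blast
qed

lemma L2_scaleR: "f \<in> L2 \<Omega> \<Longrightarrow> (\<lambda>x. c *\<^sub>R f x) \<in> L2 \<Omega>"
  by (auto simp: L2_def power_mult_distrib)

text \<open>In the expanded square the mixed term is integrable by
  \<open>L2_inner_integrable\<close>.\<close>

lemma L2_add:
  assumes "f \<in> L2 \<Omega>" "g \<in> L2 \<Omega>"
  shows "(\<lambda>x. f x + g x) \<in> L2 \<Omega>"
proof -
  have "(norm (f x + g x))\<^sup>2 = (norm (f x))\<^sup>2 + 2 * inner (f x) (g x) + (norm (g x))\<^sup>2" for x
    by (simp add: power2_norm_eq_inner inner_add_left inner_add_right inner_commute)
  then show ?thesis
    using assms L2_inner_integrable[OF assms] by (auto simp: L2_def)
qed

lemma L2_diff: "f \<in> L2 \<Omega> \<Longrightarrow> g \<in> L2 \<Omega> \<Longrightarrow> (\<lambda>x. f x - g x) \<in> L2 \<Omega>"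
  using L2_add[of f \<Omega> "\<lambda>x. (-1) *\<^sub>R g x"] L2_scaleR[of g \<Omega> "-1"] by simp

lemma L2_zero: "(\<lambda>x. 0) \<in> L2 \<Omega>"
  by (simp add: L2_def)

lemma L2_sum: "(\<And>i. i \<in> I \<Longrightarrow> f i \<in> L2 \<Omega>) \<Longrightarrow> (\<lambda>x. \<Sum>i\<in>I. c i *\<^sub>R f i x) \<in> L2 \<Omega>"
proof (induction I rule: infinite_finite_induct)
  case (insert i I)
  then show ?case using L2_add[OF L2_scaleR[of "f i" \<Omega> "c i"]] by simp
qed (auto intro: L2_zero)

lemma L2_inner_const: "f \<in> L2 \<Omega> \<Longrightarrow> (\<lambda>x. inner (f x) v) \<in> L2 \<Omega>"
proof -
  assume f: "f \<in> L2 \<Omega>"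
  have "integrable (lebesgue_on \<Omega>) (\<lambda>x. (inner (f x) v)\<^sup>2)"
  proof (rule Bochner_Integration.integrable_bound)
    show "integrable (lebesgue_on \<Omega>) (\<lambda>x. (norm (f x))\<^sup>2 * (norm v)\<^sup>2)"
      using f by (auto simp: L2_def)
    show "(\<lambda>x. (inner (f x) v)\<^sup>2) \<in> borel_measurable (lebesgue_on \<Omega>)"
      using f by (auto simp: L2_def)
    show "AE x in lebesgue_on \<Omega>. norm ((inner (f x) v)\<^sup>2) \<le> norm ((norm (f x))\<^sup>2 * (norm v)\<^sup>2)"
      using Cauchy_Schwarz_ineq by (auto simp: power2_norm_eq_inner)
  qed
  then show ?thesis using f by (auto simp: L2_def)
qed

lemma l2_inner_commute: "l2_inner \<Omega> f g = l2_inner \<Omega> g f"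
  by (simp add: l2_inner_def inner_commute)

lemma l2_inner_add_left:
  "f \<in> L2 \<Omega> \<Longrightarrow> g \<in> L2 \<Omega> \<Longrightarrow> h \<in> L2 \<Omega> \<Longrightarrow>
    l2_inner \<Omega> (\<lambda>x. f x + g x) h = l2_inner \<Omega> f h + l2_inner \<Omega> g h"
  by (simp add: l2_inner_def inner_add_left L2_inner_integrable)

lemma l2_inner_diff_left:
  "f \<in> L2 \<Omega> \<Longrightarrow> g \<in> L2 \<Omega> \<Longrightarrow> h \<in> L2 \<Omega> \<Longrightarrow>
    l2_inner \<Omega> (\<lambda>x. f x - g x) h = l2_inner \<Omega> f h - l2_inner \<Omega> g h"
  by (simp add: l2_inner_def inner_diff_left L2_inner_integrable)

lemma l2_inner_scaleR_left: "l2_inner \<Omega> (\<lambda>x. c *\<^sub>R f x) h = c * l2_inner \<Omega> f h"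
  by (simp add: l2_inner_def)

lemma l2_inner_diff_right:
  "f \<in> L2 \<Omega> \<Longrightarrow> g \<in> L2 \<Omega> \<Longrightarrow> h \<in> L2 \<Omega> \<Longrightarrow>
    l2_inner \<Omega> h (\<lambda>x. f x - g x) = l2_inner \<Omega> h f - l2_inner \<Omega> h g"
  by (simp add: l2_inner_def inner_diff_right L2_inner_integrable)

lemma l2_inner_scaleR_right: "l2_inner \<Omega> h (\<lambda>x. c *\<^sub>R f x) = c * l2_inner \<Omega> h f"
  by (simp add: l2_inner_def)

lemma l2_inner_sum_left:
  "(\<And>i. i \<in> I \<Longrightarrow> f i \<in> L2 \<Omega>) \<Longrightarrow> h \<in> L2 \<Omega> \<Longrightarrow>
    l2_inner \<Omega> (\<lambda>x. \<Sum>i\<in>I. c i *\<^sub>R f i x) h = (\<Sum>i\<in>I. c i * l2_inner \<Omega> (f i) h)"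
proof (induction I rule: infinite_finite_induct)
  case (insert i I)
  then show ?case
    by (simp add: l2_inner_add_left l2_inner_scaleR_left L2_scaleR L2_sum)
qed (simp_all add: l2_inner_def)

lemma l2_inner_sum_right:
  "(\<And>i. i \<in> I \<Longrightarrow> f i \<in> L2 \<Omega>) \<Longrightarrow> h \<in> L2 \<Omega> \<Longrightarrow>
    l2_inner \<Omega> h (\<lambda>x. \<Sum>i\<in>I. c i *\<^sub>R f i x) = (\<Sum>i\<in>I. c i * l2_inner \<Omega> h (f i))"
  unfolding l2_inner_commute[of \<Omega> h] by (rule l2_inner_sum_left)

lemma l2_inner_sum_sum:
  assumes "\<And>i. i \<in> I \<Longrightarrow> f i \<in> L2 \<Omega>" "\<And>j. j \<in> J \<Longrightarrow> g j \<in> L2 \<Omega>"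
  shows "l2_inner \<Omega> (\<lambda>x. \<Sum>i\<in>I. a i *\<^sub>R f i x) (\<lambda>x. \<Sum>j\<in>J. b j *\<^sub>R g j x)
    = (\<Sum>j\<in>J. \<Sum>i\<in>I. b j * a i * l2_inner \<Omega> (f i) (g j))"
  using assms by (simp add: l2_inner_sum_right l2_inner_sum_left L2_sum sum_distrib_left mult.assoc)

text \<open>For functions outside \<open>L2\<close> this relies on the Bochner integral being 0 when
  the integrand is not integrable.\<close>

lemma l2_inner_self_nonneg: "0 \<le> l2_inner \<Omega> f f"
  by (simp add: l2_inner_def)

lemma l2_inner_self_eq_0:
  assumes "f \<in> L2 \<Omega>" "l2_inner \<Omega> f f = 0"
  shows "AE x in lebesgue_on \<Omega>. f x = 0"
proof -
  have "AE x in lebesgue_on \<Omega>. inner (f x) (f x) = 0"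
    using assms(2) integral_nonneg_eq_0_iff_AE[OF L2_inner_integrable[OF assms(1,1)]]
    by (simp add: l2_inner_def)
  then show ?thesis by simp
qed

lemma l2_inner_AE_0: "AE x in lebesgue_on \<Omega>. g x = 0 \<Longrightarrow> l2_inner \<Omega> f g = 0"
  unfolding l2_inner_def by (rule integral_eq_zero_AE) auto

lemma l2_inner_diff_self:
  assumes "f \<in> L2 \<Omega>" "g \<in> L2 \<Omega>"
  shows "l2_inner \<Omega> (\<lambda>x. f x - g x) (\<lambda>x. f x - g x)
    = l2_inner \<Omega> f f - 2 * l2_inner \<Omega> f g + l2_inner \<Omega> g g"
  unfolding l2_inner_diff_left[OF assms L2_diff[OF assms]]
    l2_inner_diff_right[OF assms assms(1)] l2_inner_diff_right[OF assms assms(2)]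
    l2_inner_commute[of \<Omega> g f] by simp

text \<open>The square of the norm of \<open>f - t g\<close> is a nonnegative quadratic in
  \<open>t\<close>, evaluated at its minimizer \<open>?b / ?c\<close>. If \<open>?c = 0\<close>,
  then \<open>g\<close> vanishes almost everywhere.\<close>

lemma l2_Cauchy_Schwarz:
  assumes f: "f \<in> L2 \<Omega>" and g: "g \<in> L2 \<Omega>"
  shows "\<bar>l2_inner \<Omega> f g\<bar> \<le> l2_norm \<Omega> f * l2_norm \<Omega> g"
proof -
  let ?a = "l2_inner \<Omega> f f" and ?b = "l2_inner \<Omega> f g" and ?c = "l2_inner \<Omega> g g"
  have quad: "0 \<le> ?a - 2 * t * ?b + t\<^sup>2 * ?c" for t
    using l2_inner_self_nonneg[of \<Omega> "\<lambda>x. f x - t *\<^sub>R g x"] l2_inner_diff_self[OF f L2_scaleR[OF g, of t]]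
    by (simp add: l2_inner_scaleR_left l2_inner_scaleR_right power2_eq_square)
  have "?b\<^sup>2 \<le> ?a * ?c"
  proof (cases "?c = 0")
    case True
    then have "AE x in lebesgue_on \<Omega>. g x = 0" by (rule l2_inner_self_eq_0[OF g])
    then show ?thesis using True l2_inner_AE_0 by auto
  next
    case False
    then have "?c > 0" using l2_inner_self_nonneg[of \<Omega> g] by simp
    then show ?thesis using quad[of "?b / ?c"] by (simp add: field_simps power2_eq_square)
  qed
  then have "sqrt (?b\<^sup>2) \<le> sqrt (?a * ?c)" by (rule real_sqrt_le_mono)
  then show ?thesis by (simp add: l2_norm_def real_sqrt_mult)
qed

text \<open>\<open>f\<close> is bounded on the compact closure of \<open>\<Omega>\<close>, and
  \<open>\<Omega>\<close> has finite measure.\<close>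

lemma continuous_in_L2:
  fixes f :: "'a::euclidean_space \<Rightarrow> 'b::euclidean_space"
  assumes \<Omega>: "open \<Omega>" "bounded \<Omega>" and f: "continuous_on UNIV f"
  shows "f \<in> L2 \<Omega>"
proof -
  have lm: "\<Omega> \<in> lmeasurable" using \<Omega> by (intro lmeasurable_open)
  then have meas: "f \<in> borel_measurable (lebesgue_on \<Omega>)"
    using f by (intro continuous_imp_measurable_on_sets_lebesgue continuous_on_subset[OF f]) auto
  have "compact (f ` closure \<Omega>)"
    using \<Omega> f by (intro compact_continuous_image continuous_on_subset[OF f]) auto
  then obtain K where K: "\<And>x. x \<in> closure \<Omega> \<Longrightarrow> norm (f x) \<le> K"
    using compact_imp_bounded[of "f ` closure \<Omega>"] unfolding bounded_iff by (metis image_eqI)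
  interpret finite_measure "lebesgue_on \<Omega>"
    using lm by (rule finite_measure_lebesgue_on)
  have "integrable (lebesgue_on \<Omega>) (\<lambda>x. (norm (f x))\<^sup>2)"
  proof (rule integrable_const_bound[of _ "K\<^sup>2"])
    have "norm (f x) \<le> K" if "x \<in> \<Omega>" for x using K that closure_subset by blast
    then show "AE x in lebesgue_on \<Omega>. norm ((norm (f x))\<^sup>2) \<le> K\<^sup>2"
      using lm by (intro AE_I2) (auto simp: space_restrict_space intro!: power_mono)
    show "(\<lambda>x. (norm (f x))\<^sup>2) \<in> borel_measurable (lebesgue_on \<Omega>)"
      using meas by auto
  qed
  then show ?thesis using meas by (simp add: L2_def)
qed

text \<open>A coordinate is a bounded function on \<open>\<Omega>\<close>. The coordinate argument
  that takes the place of the Poincare inequality rests on this.\<close>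

lemma L2_mult_coordinate:
  assumes \<Omega>: "open \<Omega>" "bounded \<Omega>" and f: "f \<in> L2 \<Omega>"
  shows "(\<lambda>x. inner x b *\<^sub>R f x) \<in> L2 \<Omega>"
proof -
  obtain K where K: "\<And>x. x \<in> \<Omega> \<Longrightarrow> norm x \<le> K" using \<Omega>(2) by (auto simp: bounded_iff)
  have *: "norm ((norm (inner x b *\<^sub>R f x))\<^sup>2) \<le> norm ((K * norm b)\<^sup>2 * (norm (f x))\<^sup>2)" if "x \<in> \<Omega>" for x
  proof -
    have "\<bar>inner x b\<bar> \<le> norm x * norm b" by (rule Cauchy_Schwarz_ineq2)
    also have "\<dots> \<le> K * norm b" using K[OF that] by (intro mult_right_mono) auto
    finally have "\<bar>inner x b\<bar>\<^sup>2 \<le> (K * norm b)\<^sup>2" by (intro power_mono) auto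
    then show ?thesis by (simp add: power_mult_distrib mult_right_mono)
  qed
  have meas: "(\<lambda>x. inner x b) \<in> borel_measurable (lebesgue_on \<Omega>)"
    using \<Omega>(1) by (intro continuous_imp_measurable_on_sets_lebesgue continuous_intros) auto
  have "integrable (lebesgue_on \<Omega>) (\<lambda>x. (norm (inner x b *\<^sub>R f x))\<^sup>2)"
  proof (rule Bochner_Integration.integrable_bound)
    show "integrable (lebesgue_on \<Omega>) (\<lambda>x. (K * norm b)\<^sup>2 * (norm (f x))\<^sup>2)"
      using f by (auto simp: L2_def)
    show "(\<lambda>x. (norm (inner x b *\<^sub>R f x))\<^sup>2) \<in> borel_measurable (lebesgue_on \<Omega>)"
      using f meas by (auto simp: L2_def)
    show "AE x in lebesgue_on \<Omega>. norm ((norm (inner x b *\<^sub>R f x))\<^sup>2) \<le> norm ((K * norm b)\<^sup>2 * (norm (f x))\<^sup>2)"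
      using * \<Omega> by (intro AE_I2) (auto simp: space_restrict_space)
  qed
  then show ?thesis using f meas by (auto simp: L2_def)
qed

section \<open>Smooth functions and test functions\<close>

lemma smooth_iterated_deriv_differentiable:
  "smooth \<phi> \<Longrightarrow> iterated_deriv vs \<phi> differentiable (at x)"
  by (simp add: smooth_def)

lemma smooth_continuous: "smooth \<phi> \<Longrightarrow> continuous_on UNIV \<phi>"
  using smooth_iterated_deriv_differentiable[of \<phi> "[]"]
  by (auto intro!: differentiable_imp_continuous_on simp: differentiable_on_def)

lemma smooth_grad_continuous:
  assumes "smooth \<phi>" shows "continuous_on UNIV (grad \<phi>)"
proof -
  have "continuous_on UNIV (iterated_deriv [b] \<phi>)" for b
    using smooth_iterated_deriv_differentiable[OF assms, of "[b]"]
    by (intro differentiable_imp_continuous_on) (simp add: differentiable_on_def)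
  then show ?thesis
    unfolding grad_def[abs_def] by (intro continuous_on_sum continuous_on_scaleR continuous_on_const) simp
qed

lemma frechet_derivative_coordinate_mult:
  assumes "f differentiable (at x)"
  shows "frechet_derivative (\<lambda>x. inner x b * f x) (at x) v
    = inner v b * f x + inner x b * frechet_derivative f (at x) v"
proof -
  have "(f has_derivative frechet_derivative f (at x)) (at x)"
    using assms by (simp add: frechet_derivative_works)
  then have "((\<lambda>x. inner x b * f x) has_derivative
      (\<lambda>h. inner x b * frechet_derivative f (at x) h + inner h b * f x)) (at x)"
    by (auto intro!: derivative_eq_intros)
  from frechet_derivative_at[OF this, symmetric] show ?thesis by simp
qed

text \<open>Leibniz rule for a linear factor: at most one derivative can fall on it. Summand
  \<open>i\<close> is the case where direction \<open>vs ! i\<close> does, leaving the remaining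
  directions for \<open>\<phi>\<close>.\<close>

lemma iterated_deriv_coordinate_mult:
  assumes "smooth \<phi>"
  shows "iterated_deriv vs (\<lambda>x. inner x b * \<phi> x) = (\<lambda>x. inner x b * iterated_deriv vs \<phi> x
    + (\<Sum>i<length vs. inner (vs ! i) b * iterated_deriv (take i vs @ drop (Suc i) vs) \<phi> x))"
proof (induction vs)
  case (Cons v vs)
  note D = smooth_iterated_deriv_differentiable[OF assms]
  let ?S = "\<lambda>x. \<Sum>i<length vs. inner (vs ! i) b * iterated_deriv (take i vs @ drop (Suc i) vs) \<phi> x"
  show ?case
  proof
    fix x
    have S: "(?S has_derivative (\<lambda>h. \<Sum>i<length vs. inner (vs ! i) b
        * frechet_derivative (iterated_deriv (take i vs @ drop (Suc i) vs) \<phi>) (at x) h)) (at x)"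
      using D by (intro has_derivative_sum has_derivative_mult_right) (simp add: frechet_derivative_works)
    have 1: "(\<lambda>x. inner x b * iterated_deriv vs \<phi> x) differentiable (at x)"
      using D by (intro differentiable_mult differentiable_inner differentiable_ident differentiable_const)
    have "((\<lambda>x. inner x b * iterated_deriv vs \<phi> x + ?S x) has_derivative
        (\<lambda>h. frechet_derivative (\<lambda>x. inner x b * iterated_deriv vs \<phi> x) (at x) h + frechet_derivative ?S (at x) h)) (at x)"
      by (intro has_derivative_add frechet_derivative_works[THEN iffD1] 1 differentiableI[OF S])
    note this[THEN frechet_derivative_at, symmetric]
    then have "iterated_deriv (v # vs) (\<lambda>x. inner x b * \<phi> x) x
      = frechet_derivative (\<lambda>x. inner x b * iterated_deriv vs \<phi> x) (at x) v + frechet_derivative ?S (at x) v"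
      unfolding iterated_deriv.simps Cons by simp
    also have "\<dots> = inner v b * iterated_deriv vs \<phi> x + inner x b * iterated_deriv (v # vs) \<phi> x
      + (\<Sum>i<length vs. inner (vs ! i) b * iterated_deriv (v # take i vs @ drop (Suc i) vs) \<phi> x)"
      using frechet_derivative_at[OF S, symmetric] by (simp add: frechet_derivative_coordinate_mult[OF D])
    finally show "iterated_deriv (v # vs) (\<lambda>x. inner x b * \<phi> x) x
      = inner x b * iterated_deriv (v # vs) \<phi> x + (\<Sum>i<length (v # vs).
          inner ((v # vs) ! i) b * iterated_deriv (take i (v # vs) @ drop (Suc i) (v # vs)) \<phi> x)"
      by (simp only: length_Cons sum.lessThan_Suc_shift) (simp del: iterated_deriv.simps)
  qed
qed simp

text \<open>Makes the product of a coordinate and a test function admissible in the definition of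
  the weak gradient.\<close>

lemma test_functions_coordinate_mult:
  assumes "\<phi> \<in> test_functions \<Omega>"
  shows "(\<lambda>x. inner x b * \<phi> x) \<in> test_functions \<Omega>"
proof -
  have \<phi>: "smooth \<phi>" "compact (closure {x. \<phi> x \<noteq> 0})" "closure {x. \<phi> x \<noteq> 0} \<subseteq> \<Omega>"
    using assms by (auto simp: test_functions_def)
  have "iterated_deriv vs (\<lambda>x. inner x b * \<phi> x) differentiable (at x)" for vs x
    unfolding iterated_deriv_coordinate_mult[OF \<phi>(1)]
    using smooth_iterated_deriv_differentiable[OF \<phi>(1)]
    by (intro differentiable_add differentiable_sum differentiable_mult differentiable_inner
        differentiable_ident differentiable_const ballI) auto
  moreover have sub: "closure {x. inner x b * \<phi> x \<noteq> 0} \<subseteq> closure {x. \<phi> x \<noteq> 0}"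
    by (rule closure_mono) auto
  moreover have "compact (closure {x. inner x b * \<phi> x \<noteq> 0})"
    using compact_Int_closed[OF \<phi>(2) closed_closure[of "{x. inner x b * \<phi> x \<noteq> 0}"]] sub
    by (simp only: Int_absorb1)
  ultimately show ?thesis using \<phi>(3) by (auto simp: test_functions_def smooth_def)
qed

section \<open>Weak derivatives and integration by parts\<close>

lemma H10_weak_grad:
  assumes "u \<in> H10 \<Omega>"
  shows "u \<in> L2 \<Omega>" "is_weak_grad \<Omega> u (weak_grad \<Omega> u)" "weak_grad \<Omega> u \<in> L2 \<Omega>"
proof -
  show "u \<in> L2 \<Omega>" using assms by (simp add: H10_def H1_def)
  show *: "is_weak_grad \<Omega> u (weak_grad \<Omega> u)"
    using assms someI_ex[of "is_weak_grad \<Omega> u"] by (simp add: H10_def H1_def weak_grad_def)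
  then show "weak_grad \<Omega> u \<in> L2 \<Omega>" by (simp add: is_weak_grad_def)
qed

lemma Hdiv_weak_div:
  assumes "\<tau> \<in> Hdiv \<Omega>"
  shows "\<tau> \<in> L2 \<Omega>" "is_weak_div \<Omega> \<tau> (weak_div \<Omega> \<tau>)" "weak_div \<Omega> \<tau> \<in> L2 \<Omega>"
proof -
  show "\<tau> \<in> L2 \<Omega>" using assms by (simp add: Hdiv_def)
  show *: "is_weak_div \<Omega> \<tau> (weak_div \<Omega> \<tau>)"
    using assms someI_ex[of "is_weak_div \<Omega> \<tau>"] by (simp add: Hdiv_def weak_div_def)
  then show "weak_div \<Omega> \<tau> \<in> L2 \<Omega>" by (simp add: is_weak_div_def)
qed

lemma test_functions_in_L2:
  assumes "open \<Omega>" "bounded \<Omega>" "\<phi> \<in> test_functions \<Omega>"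
  shows "\<phi> \<in> L2 \<Omega>" "grad \<phi> \<in> L2 \<Omega>"
  using assms
  by (auto simp: test_functions_def intro!: continuous_in_L2 smooth_continuous smooth_grad_continuous)

text \<open>The left side is continuous in the \<open>H1\<close> norm by Cauchy-Schwarz, so its
  vanishing passes from test functions to their closure.\<close>

lemma H10_density:
  assumes \<Omega>: "open \<Omega>" "bounded \<Omega>" and u: "u \<in> H10 \<Omega>"
    and f: "f \<in> L2 \<Omega>" and F: "F \<in> L2 \<Omega>"
    and test: "\<And>\<phi>. \<phi> \<in> test_functions \<Omega> \<Longrightarrow> l2_inner \<Omega> f \<phi> + l2_inner \<Omega> F (grad \<phi>) = 0"
  shows "l2_inner \<Omega> f u + l2_inner \<Omega> F (weak_grad \<Omega> u) = 0"
proof (rule ccontr)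
  let ?t = "l2_inner \<Omega> f u + l2_inner \<Omega> F (weak_grad \<Omega> u)"
  let ?K = "l2_norm \<Omega> f + l2_norm \<Omega> F + 1"
  assume "?t \<noteq> 0"
  have K: "?K > 0" by (simp add: l2_norm_def l2_inner_self_nonneg add_nonneg_pos)
  \<comment> \<open>With this \<open>e\<close> the approximation error stays strictly below
    \<open>\<bar>?t\<bar>\<close>. The summand 1 in \<open>?K\<close> makes the bound strict and the
    denominator positive.\<close>
  define e where "e = \<bar>?t\<bar> / ?K"
  have e: "e > 0" using \<open>?t \<noteq> 0\<close> K by (simp add: e_def)
  obtain \<phi> where \<phi>: "\<phi> \<in> test_functions \<Omega>"
    "l2_norm \<Omega> (\<lambda>x. u x - \<phi> x) < e" "l2_norm \<Omega> (\<lambda>x. weak_grad \<Omega> u x - grad \<phi> x) < e"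
    using u e unfolding H10_def by blast
  note L2 = H10_weak_grad(1,3)[OF u] test_functions_in_L2[OF \<Omega> \<phi>(1)]
  have "?t = l2_inner \<Omega> f (\<lambda>x. u x - \<phi> x) + l2_inner \<Omega> F (\<lambda>x. weak_grad \<Omega> u x - grad \<phi> x)"
    using test[OF \<phi>(1)] L2 f F by (simp add: l2_inner_diff_right)
  also have "\<bar>\<dots>\<bar> \<le> \<bar>l2_inner \<Omega> f (\<lambda>x. u x - \<phi> x)\<bar> + \<bar>l2_inner \<Omega> F (\<lambda>x. weak_grad \<Omega> u x - grad \<phi> x)\<bar>"
    by (rule abs_triangle_ineq)
  also have "\<dots> \<le> l2_norm \<Omega> f * l2_norm \<Omega> (\<lambda>x. u x - \<phi> x) + l2_norm \<Omega> F * l2_norm \<Omega> (\<lambda>x. weak_grad \<Omega> u x - grad \<phi> x)"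
    using L2 f F by (intro add_mono l2_Cauchy_Schwarz L2_diff)
  also have "\<dots> \<le> l2_norm \<Omega> f * e + l2_norm \<Omega> F * e"
    using \<phi>(2,3) by (intro add_mono mult_left_mono) (auto simp: l2_norm_def l2_inner_self_nonneg)
  also have "\<dots> < ?K * e" using e by (simp add: algebra_simps)
  also have "\<dots> = \<bar>?t\<bar>" using K by (simp add: e_def)
  finally show False by simp
qed

text \<open>For test functions this is the definition of the weak divergence; density carries it to
  \<open>H10\<close>, where there is no boundary term.\<close>

lemma Hdiv_H10_integration_by_parts:
  assumes \<Omega>: "open \<Omega>" "bounded \<Omega>" and \<tau>: "\<tau> \<in> Hdiv \<Omega>" and u: "u \<in> H10 \<Omega>"
  shows "l2_inner \<Omega> \<tau> (weak_grad \<Omega> u) = - l2_inner \<Omega> (weak_div \<Omega> \<tau>) u"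
  using H10_density[OF \<Omega> u Hdiv_weak_div(3,1)[OF \<tau>]] Hdiv_weak_div(2)[OF \<tau>]
  by (simp add: is_weak_div_def)

text \<open>Obtained by testing the weak gradient of \<open>u\<close> with \<open>x\<^sub>b \<phi>\<close>, where \<open>\<phi> \<rightarrow> v\<close>.\<close>

lemma H10_coordinate_identity:
  fixes v :: "'a::euclidean_space \<Rightarrow> real"
  assumes \<Omega>: "open \<Omega>" "bounded \<Omega>" and u: "u \<in> H10 \<Omega>" and v: "v \<in> H10 \<Omega>" and b: "b \<in> Basis"
  shows "l2_inner \<Omega> u v = - l2_inner \<Omega> (\<lambda>x. inner x b * inner (weak_grad \<Omega> u x) b) v
    - l2_inner \<Omega> (\<lambda>x. (inner x b * u x) *\<^sub>R b) (weak_grad \<Omega> v)"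
proof -
  note Lu = H10_weak_grad[OF u] and Lv = H10_weak_grad[OF v]
  let ?g = "\<lambda>x. inner x b * inner (weak_grad \<Omega> u x) b"
  let ?F = "\<lambda>x. (inner x b * u x) *\<^sub>R b"
  have g: "?g \<in> L2 \<Omega>"
    using L2_mult_coordinate[OF \<Omega> L2_inner_const[OF Lu(3), of b], of b] by simp
  have xu: "(\<lambda>x. inner x b * u x) \<in> L2 \<Omega>"
    using L2_mult_coordinate[OF \<Omega> Lu(1), of b] by simp
  have F: "?F \<in> L2 \<Omega>"
    using xu b by (auto simp: L2_def)
  have "l2_inner \<Omega> (\<lambda>x. u x + ?g x) \<phi> + l2_inner \<Omega> ?F (grad \<phi>) = 0" if \<phi>: "\<phi> \<in> test_functions \<Omega>" for \<phi>
  proof -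
    have \<phi>L: "\<phi> \<in> L2 \<Omega>" "grad \<phi> \<in> L2 \<Omega>" by (rule test_functions_in_L2[OF \<Omega> \<phi>])+
    have smooth: "\<phi> differentiable (at x)" for x
      using \<phi> smooth_iterated_deriv_differentiable[of \<phi> "[]"] by (simp add: test_functions_def)
    have grad_b: "inner (grad \<psi> x) b = frechet_derivative \<psi> (at x) b" for \<psi> :: "'a \<Rightarrow> real" and x
      using b by (simp add: grad_def inner_sum_left inner_Basis if_distrib cong: if_cong)
    have "l2_inner \<Omega> u (\<lambda>x. inner (grad (\<lambda>x. inner x b * \<phi> x) x) b)
        = - l2_inner \<Omega> (\<lambda>x. inner (weak_grad \<Omega> u x) b) (\<lambda>x. inner x b * \<phi> x)"
      using Lu(2) test_functions_coordinate_mult[OF \<phi>, of b] b by (simp add: is_weak_grad_def)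
    also have "l2_inner \<Omega> (\<lambda>x. inner (weak_grad \<Omega> u x) b) (\<lambda>x. inner x b * \<phi> x) = l2_inner \<Omega> ?g \<phi>"
      by (simp add: l2_inner_def mult_ac)
    also have "(\<lambda>x. inner (grad (\<lambda>x. inner x b * \<phi> x) x) b) = (\<lambda>x. \<phi> x + inner x b * inner (grad \<phi> x) b)"
      using b by (simp add: grad_b frechet_derivative_coordinate_mult[OF smooth])
    also have "l2_inner \<Omega> u (\<lambda>x. \<phi> x + inner x b * inner (grad \<phi> x) b)
        = l2_inner \<Omega> u \<phi> + l2_inner \<Omega> u (\<lambda>x. inner x b * inner (grad \<phi> x) b)"
      using l2_inner_add_left[OF \<phi>L(1) _ Lu(1), of "\<lambda>x. inner x b * inner (grad \<phi> x) b"]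
        L2_mult_coordinate[OF \<Omega> L2_inner_const[OF \<phi>L(2), of b], of b]
      by (simp add: l2_inner_commute[of \<Omega> u])
    also have "l2_inner \<Omega> u (\<lambda>x. inner x b * inner (grad \<phi> x) b) = l2_inner \<Omega> ?F (grad \<phi>)"
      by (simp add: l2_inner_def inner_commute mult_ac)
    finally show ?thesis
      by (simp add: l2_inner_add_left[OF Lu(1) g \<phi>L(1)])
  qed
  \<comment> \<open>The identity is linear in the pair of \<open>\<phi>\<close> and
    \<open>grad \<phi>\<close>, so density replaces the pair by \<open>v\<close> and its weak
    gradient.\<close>
  then have "l2_inner \<Omega> (\<lambda>x. u x + ?g x) v + l2_inner \<Omega> ?F (weak_grad \<Omega> v) = 0"
    by (intro H10_density[OF \<Omega> v _ F] L2_add[OF Lu(1) g])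
  then show ?thesis by (simp add: l2_inner_add_left[OF Lu(1) g Lv(1)])
qed

text \<open>
  This replaces the Poincare inequality. Summing the coordinate identity over all pairs avoids
  \<open>weak_grad\<close> of the combination itself, so that uniqueness of weak derivatives is not needed.
\<close>

lemma H10_lincomb_eq_0:
  assumes \<Omega>: "open \<Omega>" "bounded \<Omega>" and u: "\<And>i. i \<in> I \<Longrightarrow> u i \<in> H10 \<Omega>"
    and 0: "AE x in lebesgue_on \<Omega>. (\<Sum>i\<in>I. y i *\<^sub>R weak_grad \<Omega> (u i) x) = 0"
  shows "AE x in lebesgue_on \<Omega>. (\<Sum>i\<in>I. y i *\<^sub>R u i x) = 0"
proof (rule l2_inner_self_eq_0)
  let ?v = "\<lambda>x. \<Sum>i\<in>I. y i *\<^sub>R u i x" and ?G = "\<lambda>x. \<Sum>i\<in>I. y i *\<^sub>R weak_grad \<Omega> (u i) x"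
  obtain b :: 'a where b: "b \<in> Basis" using nonempty_Basis by blast
  note L = H10_weak_grad[OF u]
  show v: "?v \<in> L2 \<Omega>" by (intro L2_sum L(1))
  let ?g = "\<lambda>i x. inner x b * inner (weak_grad \<Omega> (u i) x) b"
  let ?F = "\<lambda>i x. (inner x b * u i x) *\<^sub>R b"
  have g: "?g i \<in> L2 \<Omega>" if "i \<in> I" for i
    using L2_mult_coordinate[OF \<Omega> L2_inner_const[OF L(3)[OF that], of b], of b] by simp
  have F: "?F i \<in> L2 \<Omega>" if "i \<in> I" for i
    using L2_mult_coordinate[OF \<Omega> L(1)[OF that], of b] b by (auto simp: L2_def)
  have "l2_inner \<Omega> ?v ?v = (\<Sum>j\<in>I. \<Sum>i\<in>I. y j * y i * l2_inner \<Omega> (u i) (u j))"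
    by (rule l2_inner_sum_sum) (simp_all add: L(1))
  also have "\<dots> = (\<Sum>j\<in>I. \<Sum>i\<in>I. y j * y i * (- l2_inner \<Omega> (?g i) (u j) - l2_inner \<Omega> (?F i) (weak_grad \<Omega> (u j))))"
    by (intro sum.cong refl arg_cong2[of _ _ _ _ "(*)"] H10_coordinate_identity[OF \<Omega> u u b])
  also have "\<dots> = - (\<Sum>j\<in>I. \<Sum>i\<in>I. y j * y i * l2_inner \<Omega> (?g i) (u j))
      - (\<Sum>j\<in>I. \<Sum>i\<in>I. y j * y i * l2_inner \<Omega> (?F i) (weak_grad \<Omega> (u j)))"
    by (simp add: right_diff_distrib sum_subtractf sum_negf)
  \<comment> \<open>Reassembled, each of the two double sums is an inner product having
    \<open>?G\<close>, or a multiple of one of its components, as one argument; \<open>?G\<close>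
    vanishes almost everywhere.\<close>
  also have "(\<Sum>j\<in>I. \<Sum>i\<in>I. y j * y i * l2_inner \<Omega> (?g i) (u j)) = l2_inner \<Omega> (\<lambda>x. \<Sum>i\<in>I. y i *\<^sub>R ?g i x) ?v"
    by (rule l2_inner_sum_sum[symmetric]) (simp_all add: L(1) g)
  also have "\<dots> = l2_inner \<Omega> ?v (\<lambda>x. inner x b * inner (?G x) b)"
    unfolding l2_inner_commute[of \<Omega> _ ?v]
    by (simp add: inner_sum_left sum_distrib_left mult_ac)
  also have "\<dots> = 0"
    using 0 by (intro l2_inner_AE_0) (auto elim!: eventually_mono)
  also have "(\<Sum>j\<in>I. \<Sum>i\<in>I. y j * y i * l2_inner \<Omega> (?F i) (weak_grad \<Omega> (u j)))
      = l2_inner \<Omega> (\<lambda>x. \<Sum>i\<in>I. y i *\<^sub>R ?F i x) ?G"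
    by (rule l2_inner_sum_sum[symmetric]) (simp_all add: L(3) F)
  also have "\<dots> = 0"
    by (rule l2_inner_AE_0[OF 0])
  finally show "l2_inner \<Omega> ?v ?v = 0" by simp
qed

section \<open>Galerkin matrices and the eigenvalue theorem\<close>

text \<open>Brings the matrix forms into the double sums produced by
  \<open>l2_inner_sum_sum\<close>.\<close>

lemma scalar_prod_mat_mult_vec:
  fixes v w :: "'a::comm_semiring_0 vec"
  assumes "v \<in> carrier_vec p" "w \<in> carrier_vec q"
  shows "scalar_prod v (Matrix.mat p q (\<lambda>(i, j). c i j) *\<^sub>v w)
    = (\<Sum>i<p. \<Sum>j<q. vec_index v i * vec_index w j * c i j)"
  using assms
  by (auto simp: scalar_prod_def lessThan_atLeast0 sum_distrib_left mult_ac intro!: sum.cong)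

text \<open>The block form at \<open>x\<close> and \<open>y\<close> is a sum of two squared norms.
  Its vanishing forces the represented functions to be 0 almost everywhere, and independence modulo
  null sets then makes the coefficients 0.\<close>

lemma galerkin_spd_saddle:
  assumes \<Omega>: "open \<Omega>" "bounded \<Omega>"
    and \<sigma>s: "set \<sigma>s \<subseteq> Hdiv \<Omega>" "ae_independent \<Omega> \<sigma>s"
    and us: "set us \<subseteq> H10 \<Omega>" "ae_independent \<Omega> us"
  shows "spd_saddle (mat_A \<Omega> \<sigma>s) (mat_B \<Omega> \<sigma>s us) (mat_C \<Omega> us) (length \<sigma>s) (length us)"
proof
  let ?n = "length \<sigma>s" and ?m = "length us"
  show "mat_A \<Omega> \<sigma>s \<in> carrier_mat ?n ?n" by (simp add: mat_A_def)
  show "mat_B \<Omega> \<sigma>s us \<in> carrier_mat ?m ?n" by (simp add: mat_B_def)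
  show "mat_C \<Omega> us \<in> carrier_mat ?m ?m" by (simp add: mat_C_def)
  show "(mat_A \<Omega> \<sigma>s)\<^sup>T = mat_A \<Omega> \<sigma>s"
    unfolding mat_A_def by (rule eq_matI) (simp_all add: l2_inner_def inner_commute mult.commute)
  show "(mat_C \<Omega> us)\<^sup>T = mat_C \<Omega> us"
    unfolding mat_C_def by (rule eq_matI) (simp_all add: l2_inner_def inner_commute)
  fix x y :: "real vec"
  assume x: "x \<in> carrier_vec ?n" and y: "y \<in> carrier_vec ?m" and nz: "x \<noteq> 0\<^sub>v ?n \<or> y \<noteq> 0\<^sub>v ?m"
  have S: "\<sigma>s ! j \<in> Hdiv \<Omega>" if "j \<in> {..<?n}" for j using that \<sigma>s(1) by auto
  have U: "us ! i \<in> H10 \<Omega>" if "i \<in> {..<?m}" for i using that us(1) by auto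
  note LS = Hdiv_weak_div(1,3)[OF S] and LU = H10_weak_grad(1,3)[OF U]
  \<comment> \<open>\<open>\<delta>\<close> and \<open>g\<close> combine the chosen weak derivatives
    of the basis functions, so linearity of the choice operators \<open>weak_div\<close> and
    \<open>weak_grad\<close> never enters.\<close>
  define \<sigma> where "\<sigma> t = (\<Sum>j<?n. vec_index x j *\<^sub>R (\<sigma>s ! j) t)" for t
  define \<delta> where "\<delta> t = (\<Sum>j<?n. vec_index x j *\<^sub>R weak_div \<Omega> (\<sigma>s ! j) t)" for t
  define u where "u t = (\<Sum>i<?m. vec_index y i *\<^sub>R (us ! i) t)" for t
  define g where "g t = (\<Sum>i<?m. vec_index y i *\<^sub>R weak_grad \<Omega> (us ! i) t)" for t
  have L: "\<sigma> \<in> L2 \<Omega>" "\<delta> \<in> L2 \<Omega>" "g \<in> L2 \<Omega>"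
    unfolding \<sigma>_def[abs_def] \<delta>_def[abs_def] g_def[abs_def] by (intro L2_sum LS LU; assumption)+
  have inner:
    "l2_inner \<Omega> \<sigma> \<sigma> = (\<Sum>i<?n. \<Sum>j<?n. vec_index x i * vec_index x j * l2_inner \<Omega> (\<sigma>s ! j) (\<sigma>s ! i))"
    "l2_inner \<Omega> \<delta> \<delta> = (\<Sum>i<?n. \<Sum>j<?n. vec_index x i * vec_index x j
      * l2_inner \<Omega> (weak_div \<Omega> (\<sigma>s ! j)) (weak_div \<Omega> (\<sigma>s ! i)))"
    "l2_inner \<Omega> \<sigma> g = (\<Sum>i<?m. \<Sum>j<?n. vec_index y i * vec_index x j
      * l2_inner \<Omega> (\<sigma>s ! j) (weak_grad \<Omega> (us ! i)))"
    "l2_inner \<Omega> g g = (\<Sum>i<?m. \<Sum>j<?m. vec_index y i * vec_index y j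
      * l2_inner \<Omega> (weak_grad \<Omega> (us ! j)) (weak_grad \<Omega> (us ! i)))"
    "l2_inner \<Omega> \<delta> u = (\<Sum>i<?m. \<Sum>j<?n. vec_index y i * vec_index x j
      * l2_inner \<Omega> (weak_div \<Omega> (\<sigma>s ! j)) (us ! i))"
    unfolding \<sigma>_def[abs_def] \<delta>_def[abs_def] g_def[abs_def] u_def[abs_def]
    by (rule l2_inner_sum_sum; erule LS LU)+
  have "scalar_prod x (mat_A \<Omega> \<sigma>s *\<^sub>v x) = l2_inner \<Omega> \<sigma> \<sigma> + l2_inner \<Omega> \<delta> \<delta>"
    unfolding mat_A_def scalar_prod_mat_mult_vec[OF x x] inner
    by (simp add: distrib_left sum.distrib)
  moreover have "scalar_prod y (mat_B \<Omega> \<sigma>s us *\<^sub>v x) = - l2_inner \<Omega> \<sigma> g"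
    unfolding mat_B_def scalar_prod_mat_mult_vec[OF y x] inner by (simp add: sum_negf)
  moreover have "scalar_prod y (mat_C \<Omega> us *\<^sub>v y) = l2_inner \<Omega> g g"
    unfolding mat_C_def scalar_prod_mat_mult_vec[OF y y] inner ..
  \<comment> \<open>Completing the square: the off-diagonal blocks contribute the cross term, minus
    twice the inner product of \<open>\<sigma>\<close> and \<open>g\<close>.\<close>
  ultimately have eq: "scalar_prod x (mat_A \<Omega> \<sigma>s *\<^sub>v x) + 2 * scalar_prod y (mat_B \<Omega> \<sigma>s us *\<^sub>v x)
      + scalar_prod y (mat_C \<Omega> us *\<^sub>v y)
    = l2_inner \<Omega> (\<lambda>t. \<sigma> t - g t) (\<lambda>t. \<sigma> t - g t) + l2_inner \<Omega> \<delta> \<delta>" (is "?q = _")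
    by (simp add: l2_inner_diff_self[OF L(1,3)])
  show "0 < ?q"
  proof (rule ccontr)
    assume "\<not> 0 < ?q"
    then have 0: "l2_inner \<Omega> (\<lambda>t. \<sigma> t - g t) (\<lambda>t. \<sigma> t - g t) = 0" "l2_inner \<Omega> \<delta> \<delta> = 0"
      using l2_inner_self_nonneg[of \<Omega> "\<lambda>t. \<sigma> t - g t"] l2_inner_self_nonneg[of \<Omega> \<delta>]
      unfolding eq by linarith+
    have \<sigma>g: "AE t in lebesgue_on \<Omega>. \<sigma> t - g t = 0"
      by (rule l2_inner_self_eq_0[OF L2_diff[OF L(1,3)] 0(1)])
    have "l2_inner \<Omega> \<sigma> g = (\<Sum>i<?m. \<Sum>j<?n. vec_index y i * vec_index x j
        * - l2_inner \<Omega> (weak_div \<Omega> (\<sigma>s ! j)) (us ! i))"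
      unfolding inner
      by (intro sum.cong refl arg_cong2[of _ _ _ _ "(*)"] Hdiv_H10_integration_by_parts[OF \<Omega> S U])
    also have "\<dots> = - l2_inner \<Omega> \<delta> u"
      unfolding inner by (simp add: sum_negf)
    also have "\<dots> = 0"
      using l2_inner_AE_0[OF l2_inner_self_eq_0[OF L(2) 0(2)]] by (simp add: l2_inner_commute[of _ \<delta>])
    \<comment> \<open>As \<open>\<sigma>\<close> is orthogonal to \<open>g\<close>, subtracting
      \<open>g\<close> in one argument changes nothing, and the difference is 0 almost
      everywhere.\<close>
    finally have "l2_inner \<Omega> \<sigma> \<sigma> = l2_inner \<Omega> \<sigma> (\<lambda>t. \<sigma> t - g t)"
      by (simp add: l2_inner_diff_right[OF L(1,3,1)])
    also have "\<dots> = 0" by (rule l2_inner_AE_0[OF \<sigma>g])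
    finally have \<sigma>0: "AE t in lebesgue_on \<Omega>. \<sigma> t = 0"
      by (rule l2_inner_self_eq_0[OF L(1)])
    then have "vec_index x j = 0" if "j < ?n" for j
      using \<sigma>s(2) that unfolding ae_independent_def \<sigma>_def by blast
    then have "x = 0\<^sub>v ?n" using x by (intro eq_vecI) auto
    moreover have "AE t in lebesgue_on \<Omega>. g t = 0"
      using \<sigma>g \<sigma>0 by eventually_elim simp
    then have "AE t in lebesgue_on \<Omega>. u t = 0"
      unfolding g_def u_def by (intro H10_lincomb_eq_0[OF \<Omega> U])
    then have "vec_index y i = 0" if "i < ?m" for i
      using us(2) that unfolding ae_independent_def u_def by blast
    then have "y = 0\<^sub>v ?m" using y by (intro eq_vecI) auto
    ultimately show False using nz by simp
  qed
qed

text \<open>The Galerkin matrices satisfy \<open>spd_saddle\<close>, and the length of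
  \<open>\<sigma>s\<close> is the dimension of \<open>\<Sigma>h\<close>. The explicit eigenspace at
  infinity separates the first two families: \<open>x\<close> ranges over all vectors,
  \<open>y\<close> over the kernel of the transposed matrix.\<close>

theorem proposition4:
  fixes \<Omega> :: "'a::euclidean_space set"
    and \<Sigma>h :: "('a \<Rightarrow> 'a) set" and Uh :: "('a \<Rightarrow> real) set"
    and \<sigma>s :: "('a \<Rightarrow> 'a) list" and us :: "('a \<Rightarrow> real) list"
    and A B C :: "real mat" and P Q :: "complex mat"
  assumes "bounded \<Omega>" and "lipschitz_domain \<Omega>"
    and "fun_subspace \<Sigma>h" and "\<Sigma>h \<subseteq> Hdiv \<Omega>" and "ae_basis \<Omega> \<sigma>s \<Sigma>h"
    and "fun_subspace Uh" and "Uh \<subseteq> H10 \<Omega>" and "ae_basis \<Omega> us Uh"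
    and "A = mat_A \<Omega> \<sigma>s" and "B = mat_B \<Omega> \<sigma>s us" and "C = mat_C \<Omega> us"
    and "P = map_mat complex_of_real
               (four_block_mat A (transpose_mat B) B C)"
    and "Q = map_mat complex_of_real
               (four_block_mat (0\<^sub>m (length \<sigma>s) (length \<sigma>s)) (- transpose_mat B)
                               (0\<^sub>m (length us) (length \<sigma>s)) (0\<^sub>m (length us) (length us)))"
  shows "invertible_mat P
    \<and> gen_eigenspace P Q Infty =
        {x @\<^sub>v y | x y. x \<in> carrier_vec (ae_dim \<Omega> \<Sigma>h) \<and>
                     y \<in> mat_kernel (map_mat complex_of_real (transpose_mat B))}
    \<and> geom_mult P Q Infty = ae_dim \<Omega> \<Sigma>h + kernel_dim (transpose_mat B)
    \<and> alg_mult P Q Infty = ae_dim \<Omega> \<Sigma>h + kernel_dim (transpose_mat B)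
    \<and> (\<forall>l. gen_eigenvalue P Q (Fin l) \<longrightarrow> (\<exists>r>0. l = complex_of_real r))
    \<and> finite {l. gen_eigenvalue P Q (Fin l)}
    \<and> (\<Sum>l | gen_eigenvalue P Q (Fin l). geom_mult P Q (Fin l))
        = vec_space.rank (dim_row (transpose_mat B)) (transpose_mat B)
    \<and> (\<Sum>l | gen_eigenvalue P Q (Fin l). alg_mult P Q (Fin l))
        = vec_space.rank (dim_row (transpose_mat B)) (transpose_mat B)"
proof -
  let ?n = "length \<sigma>s" and ?m = "length us"
  interpret S: spd_saddle A B C ?n ?m
    unfolding assms(9-11)
    using assms by (intro galerkin_spd_saddle) (auto simp: lipschitz_domain_def ae_basis_def)
  have PQ: "P = S.P" "Q = S.Q"
    unfolding S.P_def S.Q_def assms(12,13) by (rule refl)+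
  have dim: "ae_dim \<Omega> \<Sigma>h = ?n" by (rule ae_dim_eq_length[OF assms(5)])
  have row: "dim_row B\<^sup>T = ?n" using S.B by simp
  show ?thesis
    unfolding PQ dim row
    by (intro conjI allI impI S.saddle_pencil) (use S.mat_kernel_Q in simp)
qed

end
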